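(* Let $h>0$, $\alpha\in\mathrm{DC}^1$, and let $v(x)=\sum_{k>0}\widehat v_k\,\mathrm{e}^{\mathrm{i}kx}\in C^\omega(\mathbb{T}_h,\mathbb{C})$ (sum over positive integers $k$). Then there exists $\lambda_1=\lambda_1(h,\alpha,\|v\|_h)>0$ such that for every $\lambda\in\mathbb{R}$ with $|\lambda|<\lambda_1$ one has $\Sigma_{\lambda v,\alpha}=[-2,2]$.
   Context: $\mathbb{T}=\mathbb{R}/2\pi\mathbb{Z}$. $C^\omega(\mathbb{T}_h,\mathbb{C})$ is the space of functions $v(x)=\sum_{k\in\mathbb{Z}}\widehat v_k\mathrm{e}^{\mathrm{i}kx}$ on the strip $|\mathrm{Im}\,x|<h$ with $\|v\|_h=\sum_k|\widehat v_k|\mathrm{e}^{h|k|}<\infty$. For $\gamma\in(0,1)$ and fixed $\tau>1$, $\mathrm{DC}^1_{\gamma,\tau}$ is the set of $\alpha\in[1,2]$ with $\inf_{n\in\mathbb{Z}}|k\alpha-2\pi n|\ge\frac{\gamma}{1+|k|^\tau}$ for all $k\in\mathbb{Z}\setminus\{0\}$, and $\mathrm{DC}^1=\bigcup_{\gamma>0}\mathrm{DC}^1_{\gamma,\tau}$. Operator: on $\ell^2(\mathbb{Z})$, $(H_{\lambda v,\alpha,x}\psi)_n=\psi_{n+1}+\psi_{n-1}+\lambda v(x+n\alpha)\psi_n$, $x\in\mathbb{T}$. Its spectrum does not depend on $x$ and is denoted $\Sigma_{\lambda v,\alpha}$. *)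

theory Defs
  imports "HOL-Analysis.Analysis"
begin

(* A function on T = R/2piZ, extended to the strip |Im x| < h, is represented by a total
   function complex => complex; only its values on the strip matter, and its 2pi-periodicity
   follows from the Fourier expansion required below. *)

definition fourier_coeff :: "(complex \<Rightarrow> complex) \<Rightarrow> int \<Rightarrow> complex" where
  "fourier_coeff v k =
     integral {0..2 * pi} (\<lambda>t. v (complex_of_real t) * exp (- (\<i> * of_int k * complex_of_real t)))
       / complex_of_real (2 * pi)"

definition strip_norm :: "real \<Rightarrow> (complex \<Rightarrow> complex) \<Rightarrow> real" where
  "strip_norm h v = (\<Sum>\<^sub>\<infinity>k. cmod (fourier_coeff v k) * exp (h * \<bar>real_of_int k\<bar>))"

definition C_omega :: "real \<Rightarrow> (complex \<Rightarrow> complex) set" where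
  "C_omega h = {v.
     (\<lambda>k. cmod (fourier_coeff v k) * exp (h * \<bar>real_of_int k\<bar>)) summable_on UNIV \<and>
     (\<forall>z. \<bar>Im z\<bar> < h \<longrightarrow> ((\<lambda>k. fourier_coeff v k * exp (\<i> * of_int k * z)) has_sum v z) UNIV)}"

definition DC1_const :: "real \<Rightarrow> real \<Rightarrow> real set" where
  "DC1_const \<gamma> \<tau> = {\<alpha> \<in> {1..2}. \<forall>k::int. k \<noteq> 0 \<longrightarrow>
     (INF n::int. \<bar>real_of_int k * \<alpha> - 2 * pi * real_of_int n\<bar>)
       \<ge> \<gamma> / (1 + \<bar>real_of_int k\<bar> powr \<tau>)}"

definition DC1 :: "real \<Rightarrow> real set" where
  "DC1 \<tau> = (\<Union>\<gamma>\<in>{0<..<1}. DC1_const \<gamma> \<tau>)"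

definition l2 :: "(int \<Rightarrow> complex) set" where
  "l2 = {\<psi>. (\<lambda>n. (cmod (\<psi> n))\<^sup>2) summable_on UNIV}"

definition l2_norm :: "(int \<Rightarrow> complex) \<Rightarrow> real" where
  "l2_norm \<psi> = sqrt (\<Sum>\<^sub>\<infinity>n. (cmod (\<psi> n))\<^sup>2)"

definition l2_bounded_op :: "((int \<Rightarrow> complex) \<Rightarrow> (int \<Rightarrow> complex)) \<Rightarrow> bool" where
  "l2_bounded_op T \<longleftrightarrow>
     (\<forall>\<psi>\<in>l2. T \<psi> \<in> l2) \<and>
     (\<forall>\<psi>\<in>l2. \<forall>\<phi>\<in>l2. T (\<lambda>n. \<psi> n + \<phi> n) = (\<lambda>n. T \<psi> n + T \<phi> n)) \<and>
     (\<forall>c. \<forall>\<psi>\<in>l2. T (\<lambda>n. c * \<psi> n) = (\<lambda>n. c * T \<psi> n)) \<and>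
     (\<exists>C. \<forall>\<psi>\<in>l2. l2_norm (T \<psi>) \<le> C * l2_norm \<psi>)"

definition l2_resolvent_set :: "((int \<Rightarrow> complex) \<Rightarrow> (int \<Rightarrow> complex)) \<Rightarrow> complex set" where
  "l2_resolvent_set T = {E. \<exists>R. l2_bounded_op R \<and>
     (\<forall>\<psi>\<in>l2. R (\<lambda>n. T \<psi> n - E * \<psi> n) = \<psi> \<and> (\<lambda>n. T (R \<psi>) n - E * R \<psi> n) = \<psi>)}"

definition l2_spectrum :: "((int \<Rightarrow> complex) \<Rightarrow> (int \<Rightarrow> complex)) \<Rightarrow> complex set" where
  "l2_spectrum T = - l2_resolvent_set T"

(* schroedinger w alpha x is the operator H_{w, alpha, x}; the coupling constant is part of w. *)
definition schroedinger ::
  "(complex \<Rightarrow> complex) \<Rightarrow> real \<Rightarrow> real \<Rightarrow> (int \<Rightarrow> complex) \<Rightarrow> (int \<Rightarrow> complex)" where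
  "schroedinger w \<alpha> x \<psi> =
     (\<lambda>n. \<psi> (n + 1) + \<psi> (n - 1) + w (complex_of_real (x + real_of_int n * \<alpha>)) * \<psi> n)"

end

theory Submission
  imports Defs
begin

text \<open>Write \<open>a = exp (\<i> \<alpha>)\<close> and \<open>E = z + 1 / z\<close> with \<open>\<bar>z\<bar> \<le> 1\<close>. Since \<open>v\<close> has only positive frequencies, the
  coefficients of a Bloch wave \<open>z\<^sup>n (\<Sum>k\<ge>0. P\<^sub>k exp (\<i> k (x + n \<alpha>)))\<close> solve a triangular recursion with
  divisors \<open>(1 - a\<^sup>k) (1 - z\<^sup>2 a\<^sup>k)\<close> up to a factor of modulus \<open>\<ge> 1\<close>. A divisor occurs at most once along the
  recursion, and by the Diophantine condition small divisors are so sparse that their product is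
  beaten by the decay \<open>exp (- h k)\<close> of the potential, for a coupling threshold independent of \<open>z\<close>.
  Replacing \<open>a\<close> by \<open>1 / a\<close> gives a second solution \<open>z\<^bsup>-n\<^esup> (\<dots>)\<close>, and the Wronskian of the two is exactly
  \<open>1 / z - z\<close>.

  If \<open>E \<notin> [-2, 2]\<close>, then \<open>\<bar>z\<bar> < 1\<close>, both solutions decay exponentially in opposite directions, and the
  Green kernel built from them is the resolvent. For \<open>z = exp (\<i> (2 m + 1) \<alpha> / 4)\<close> there are no resonances,
  so both solutions are bounded and truncations of the first are approximate eigenvectors; these
  energies are dense in \<open>[-2, 2]\<close>.\<close>

unbundle no vec_syntax and fps_syntax

section \<open>Small divisors\<close>

text \<open>Blocks of length \<open>L\<close> hold at most one element of \<open>A\<close> each, so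
  \<open>n div L\<close> is injective on \<open>A\<close>. As all elements are at least
  \<open>L\<close>, block 0 stays empty; this avoids an additive 1 in the count, which would spoil
  the bound at large scales.\<close>

lemma card_separated_nat_le:
  fixes A :: "nat set"
  assumes "A \<subseteq> {1..N}" "L > 0" "\<And>n. n \<in> A \<Longrightarrow> L \<le> n"
    and "\<And>m n. m \<in> A \<Longrightarrow> n \<in> A \<Longrightarrow> m < n \<Longrightarrow> L \<le> n - m"
  shows "card A * L \<le> N"
proof -
  have inj: "inj_on (\<lambda>n. n div L) A"
  proof (rule linorder_inj_onI')
    fix m n assume mn: "m \<in> A" "n \<in> A" "m < n"
    then have "m + L \<le> n" using assms(4)[OF mn] by simp
    then have "(m + L) div L \<le> n div L" by (rule div_le_mono)
    then show "m div L \<noteq> n div L" using \<open>L > 0\<close> by simp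
  qed
  have "(\<lambda>n. n div L) ` A \<subseteq> {1..N div L}"
  proof
    fix y assume "y \<in> (\<lambda>n. n div L) ` A"
    then obtain n where n: "n \<in> A" "y = n div L" by blast
    have "n \<le> N" using n assms(1) by auto
    then show "y \<in> {1..N div L}"
      using assms(3)[OF n(1)] \<open>L > 0\<close> n(2) by (simp add: div_le_mono Suc_le_eq div_greater_zero_iff)
  qed
  then have "card A \<le> N div L"
    using card_inj_on_le[OF inj, of "{1..N div L}"] by simp
  then have "card A * L \<le> N div L * L" by (rule mult_le_mono1)
  also have "\<dots> \<le> N" by simp
  finally show ?thesis .
qed

text \<open>Layer-cake decomposition: every threshold \<open>e / b ^ j\<close> above
  \<open>y\<close> contributes one factor \<open>b\<close>, and these factors together exceed
  \<open>e / y\<close>. A product over indices thus becomes a product over scales, where the indices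
  below each threshold can be counted. \<open>J\<close> is only a cutoff.\<close>

lemma max_divide_le_prod_dyadic:
  fixes y e b :: real
  assumes "b \<ge> 1" "e > 0" "y > 0" "e / b ^ J \<le> y"
  shows "max 1 (e / y) \<le> (\<Prod>j<J. if y < e / b ^ j then b else 1)"
  using assms(4)
proof (induction J)
  case 0
  then show ?case using assms by (simp add: divide_simps)
next
  case (Suc J)
  show ?case
  proof (cases "e / b ^ J \<le> y")
    case True
    have "(1::real) \<le> (if y < e / b ^ J then b else 1)" using assms by simp
    from mult_mono[OF Suc.IH[OF True] this] show ?thesis
      using assms by (simp add: max_def prod_nonneg)
  next
    case False
    have "y < e / b ^ j" if "j \<le> J" for j
    proof -
      have "e / b ^ J \<le> e / b ^ j"
        using that assms by (intro divide_left_mono power_increasing) auto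
      then show ?thesis using False by simp
    qed
    then have "(\<Prod>j<Suc J. if y < e / b ^ j then b else 1) = (\<Prod>j<Suc J. b)"
      by (intro prod.cong) auto
    moreover have "e / y \<le> b ^ Suc J"
      using Suc.prems assms by (simp add: divide_simps mult.commute split: if_splits)
    moreover have "1 \<le> b ^ Suc J" using assms(1) by (rule one_le_power)
    ultimately show ?thesis by simp
  qed
qed

text \<open>Siegel's counting argument: indices with a divisor below \<open>c / (2 L ^ T)\<close> are \<open>L\<close>-separated,
  and summing over the dyadic scales \<open>L = L\<^sub>0 2\<^sup>j\<close> makes the exponential rate arbitrarily small.\<close>

lemma prod_small_divisors_le:
  fixes a :: complex and c \<eta> :: real
  assumes a: "cmod a = 1" and c: "c > 0" and \<eta>: "\<eta> > 0"
    and dc: "\<And>n::nat. n \<ge> 1 \<Longrightarrow> c / real n ^ T \<le> cmod (1 - a ^ n)"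
  shows "\<exists>e>0. \<forall>e'\<in>{0<..e}. \<forall>N. (\<Prod>n=1..N. max 1 (e' / cmod (1 - a ^ n))) \<le> exp (\<eta> * real N)"
proof -
  \<comment> \<open>The sum over scales will produce the rate \<open>2 * ln b / L0\<close> with
    \<open>ln b = T * ln 2\<close>; this choice makes it at most \<open>\<eta>\<close>.\<close>
  obtain L :: nat where "2 * real T * ln 2 / \<eta> < real L"
    using reals_Archimedean2 by blast
  then obtain L0 :: nat where L0: "2 * real T * ln 2 / \<eta> < real L0" "L0 > 0"
    by (rule_tac that[of "Suc L"]) auto
  define g where "g n = cmod (1 - a ^ n)" for n
  define b :: real where "b = 2 ^ T"
  \<comment> \<open>The factor 2 lets two divisors below \<open>e / b ^ j\<close> add up to less
    than \<open>c / L ^ T\<close>, where \<open>L = L0 * 2 ^ j\<close>. By \<open>gdiff\<close> and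
    \<open>far\<close>, their indices then differ by at least \<open>L\<close>.\<close>
  define e where "e = c / (2 * real L0 ^ T)"
  have e: "e > 0" using c L0 by (simp add: e_def)
  have b: "b \<ge> 1" by (simp add: b_def)
  have gpos: "g n > 0" if "n \<ge> 1" for n
    using less_le_trans[OF divide_pos_pos dc[OF that]] c that by (simp add: g_def)
  have gdiff: "g (n - m) \<le> g n + g m" if "m < n" for m n
  proof -
    have "a ^ n = a ^ m * a ^ (n - m)" using that by (simp flip: power_add)
    then have "cmod (a ^ m * (1 - a ^ (n - m))) \<le> g n + g m"
      unfolding g_def using norm_triangle_ineq4[of "1 - a ^ n" "1 - a ^ m"]
      by (simp add: algebra_simps norm_minus_commute)
    then show ?thesis by (simp add: g_def norm_mult norm_power a)
  qed
  have count: "real (card {n\<in>{1..N}. g n < e / b ^ j}) \<le> real N / (real L0 * 2 ^ j)" for N j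
  proof -
    define L where "L = L0 * 2 ^ j"
    have L: "L > 0" using L0 by (simp add: L_def)
    have eb: "e / b ^ j = c / (2 * real L ^ T)"
      by (simp add: e_def b_def L_def power_mult_distrib power_mult[symmetric] mult.commute)
    have far: "L \<le> n" if "n \<ge> 1" "g n < c / real L ^ T" for n
    proof (rule ccontr)
      assume "\<not> L \<le> n"
      then have "real n ^ T \<le> real L ^ T" by (intro power_mono) auto
      then have "c / real L ^ T \<le> c / real n ^ T" using that c L
        by (intro divide_left_mono) auto
      with dc[OF that(1)] that(2) show False by (simp add: g_def)
    qed
    have half: "c / (2 * real L ^ T) + c / (2 * real L ^ T) = c / real L ^ T" by simp
    have pos: "c / (2 * real L ^ T) > 0" using c L by simp
    have "card {n\<in>{1..N}. g n < e / b ^ j} * L \<le> N"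
    proof (rule card_separated_nat_le)
      fix n assume "n \<in> {n\<in>{1..N}. g n < e / b ^ j}"
      then show "L \<le> n" using far[of n] half pos eb by auto
    next
      fix m n assume mn: "m \<in> {n\<in>{1..N}. g n < e / b ^ j}" "n \<in> {n\<in>{1..N}. g n < e / b ^ j}" "m < n"
      then show "L \<le> n - m" using far[of "n - m"] gdiff[OF mn(3)] half eb by auto
    qed (use L in auto)
    then have "real (card {n\<in>{1..N}. g n < e / b ^ j} * L) \<le> real N" by (simp only: of_nat_le_iff)
    then show ?thesis using L0 by (simp add: L_def field_simps)
  qed
  have main: "(\<Prod>n=1..N. max 1 (e / g n)) \<le> exp (\<eta> * real N)" for N
  proof -
    \<comment> \<open>The cutoff may depend on \<open>N\<close>, because the geometric sum over
      scales is bounded by 2 for every \<open>J\<close>. For \<open>T = 0\<close> the thresholds do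
      not shrink, but then \<open>e \<le> c / 2\<close> already lies below all divisors.\<close>
    have "\<exists>J. \<forall>n\<in>{1..N}. e / b ^ J \<le> g n" if "T > 0"
    proof -
      have b1: "b > 1" using that by (simp add: b_def)
      have "(\<lambda>J. e / b ^ J) \<longlonglongrightarrow> 0" using b1 LIMSEQ_divide_realpow_zero by blast
      then have "\<forall>\<^sub>F J in sequentially. e / b ^ J \<le> g n" if "n \<in> {1..N}" for n
        using gpos[of n] that by (intro order_tendstoD(2)[THEN eventually_mono]) auto
      then have "\<forall>\<^sub>F J in sequentially. \<forall>n\<in>{1..N}. e / b ^ J \<le> g n"
        by (intro eventually_ball_finite) auto
      then show ?thesis by (auto simp: eventually_sequentially)
    qed
    moreover have "\<forall>n\<in>{1..N}. e / b ^ 0 \<le> g n" if "T = 0"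
    proof
      fix n assume "n \<in> {1..N}"
      then show "e / b ^ 0 \<le> g n" using dc[of n] c that by (simp add: g_def e_def)
    qed
    ultimately obtain J where "\<forall>n\<in>{1..N}. e / b ^ J \<le> g n" by blast
    then have J: "\<And>n. n \<in> {1..N} \<Longrightarrow> e / b ^ J \<le> g n" by blast
    have "(\<Prod>n=1..N. max 1 (e / g n)) \<le> (\<Prod>n=1..N. \<Prod>j<J. if g n < e / b ^ j then b else 1)"
      using b e gpos J by (intro prod_mono conjI max_divide_le_prod_dyadic) auto
    also have "\<dots> = (\<Prod>j<J. \<Prod>n=1..N. if g n < e / b ^ j then b else 1)"
      by (rule prod.swap)
    also have "\<dots> = (\<Prod>j<J. b ^ card {n\<in>{1..N}. g n < e / b ^ j})"
      by (simp add: prod.If_cases Int_def)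
    also have "\<dots> \<le> (\<Prod>j<J. exp (ln b * (real N / (real L0 * 2 ^ j))))"
    proof (intro prod_mono conjI)
      fix j
      have "b ^ card {n\<in>{1..N}. g n < e / b ^ j} = exp (ln b * real (card {n\<in>{1..N}. g n < e / b ^ j}))"
        using b by (simp add: exp_of_nat2_mult)
      also have "\<dots> \<le> exp (ln b * (real N / (real L0 * 2 ^ j)))"
        using count[of N j] b by (simp only: exp_le_cancel_iff, intro mult_left_mono) auto
      finally show "b ^ card {n\<in>{1..N}. g n < e / b ^ j} \<le> exp (ln b * (real N / (real L0 * 2 ^ j)))" .
    qed (use b in auto)
    also have "\<dots> = exp ((ln b * real N / real L0) * (\<Sum>j<J. (1/2) ^ j))"
      by (simp add: exp_sum sum_distrib_left power_one_over field_simps)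
    also have "\<dots> \<le> exp ((ln b * real N / real L0) * 2)"
    proof -
      have "(\<Sum>j<J. (1/2) ^ j) \<le> (2::real)" by (simp add: sum_gp_strict)
      then show ?thesis using b by (simp only: exp_le_cancel_iff, intro mult_left_mono) auto
    qed
    also have "\<dots> \<le> exp (\<eta> * real N)"
    proof -
      have "2 * (real T * ln 2) \<le> \<eta> * real L0" using L0 \<eta> by (simp add: field_simps)
      then have "2 * (real T * ln 2) * real N \<le> \<eta> * real L0 * real N" by (rule mult_right_mono) simp
      then show ?thesis using L0 by (simp add: b_def ln_realpow field_simps)
    qed
    finally show ?thesis .
  qed
  show ?thesis
  proof (intro exI conjI ballI allI)
    fix e' N assume e': "e' \<in> {0<..e}"
    have "(\<Prod>n=1..N. max 1 (e' / g n)) \<le> (\<Prod>n=1..N. max 1 (e / g n))"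
      using e' by (intro prod_mono conjI max.mono divide_right_mono) (auto simp: g_def max_def)
    with main[of N] show "(\<Prod>n=1..N. max 1 (e' / cmod (1 - a ^ n))) \<le> exp (\<eta> * real N)"
      by (simp add: g_def)
  qed (rule e)
qed

text \<open>Compared with the index \<open>k\<close> that minimises \<open>\<bar>1 - \<zeta> a\<^sup>k\<bar>\<close>, every other divisor is at least a
  quarter of \<open>\<bar>1 - a\<^bsup>n - k\<^esup>\<bar>\<close>, so that only one factor depends on \<open>d\<close>.\<close>

lemma prod_shifted_divisors_le:
  fixes a \<zeta> :: complex and d e \<eta> :: real
  assumes a: "cmod a = 1" and \<zeta>: "cmod \<zeta> \<le> 1" and d: "d > 0" and e: "0 < e" "e \<le> 1/2"
    and G: "\<And>N. (\<Prod>n=1..N. max 1 (4 * e / cmod (1 - a ^ n))) \<le> exp (\<eta> * real N)"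
    and \<eta>: "\<eta> \<ge> 0" and nz: "\<And>n. n \<ge> 1 \<Longrightarrow> a ^ n \<noteq> 1"
    and w: "\<And>n::nat. n \<ge> 1 \<Longrightarrow> d / real n ^ T \<le> cmod (1 - \<zeta> * a ^ n)"
  shows "(\<Prod>n=1..N. max 1 (e / cmod (1 - \<zeta> * a ^ n))) \<le> (1 + 1 / d) * (1 + real N) ^ T * exp (\<eta> * real N)"
proof -
  define g where "g n = cmod (1 - a ^ n)" for n
  define u where "u n = cmod (1 - \<zeta> * a ^ n)" for n
  have upos: "u n > 0" if "n \<ge> 1" for n
    using less_le_trans[OF divide_pos_pos w[OF that]] d that by (simp add: u_def)
  have C1: "1 \<le> (1 + 1 / d) * (1 + real N) ^ T"
    using d mult_mono[of 1 "1 + 1/d" 1 "(1 + real N) ^ T"] by simp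
  show ?thesis
  proof (cases "N = 0 \<or> cmod \<zeta> < 1/2")
    case True
    \<comment> \<open>For a small \<open>\<zeta>\<close> all divisors exceed 1/2, which is at least
      \<open>e\<close>, so there is nothing to estimate.\<close>
    have "max 1 (e / u n) = 1" if "n \<in> {1..N}" for n
    proof -
      have "cmod (\<zeta> * a ^ n) < 1/2" using True that by (auto simp: norm_mult norm_power a)
      then have "1/2 < u n" unfolding u_def
        using norm_triangle_ineq2[of 1 "\<zeta> * a ^ n"] by simp
      then show ?thesis using e by (simp add: max_def divide_simps)
    qed
    then have "(\<Prod>n=1..N. max 1 (e / u n)) = 1 * 1" by simp
    also have "(1::real) * 1 \<le> (1 + 1 / d) * (1 + real N) ^ T * exp (\<eta> * real N)"
      using C1 \<eta> by (intro mult_mono) auto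
    finally show ?thesis by (simp add: u_def)
  next
    case False
    then have N: "N \<ge> 1" and \<zeta>2: "cmod \<zeta> \<ge> 1/2" by auto
    obtain k where k: "k \<in> {1..N}" "\<And>n. n \<in> {1..N} \<Longrightarrow> u k \<le> u n"
      using ex_is_arg_min_if_finite[of "{1..N}" u] N
      by (auto simp: is_arg_min_linorder)
    \<comment> \<open>Subtracting the divisors at \<open>n\<close> and \<open>k\<close> gives
      \<open>cmod \<zeta> * g m \<le> u n + u k\<close>, and minimality of \<open>u k\<close> bounds
      the right side by \<open>2 * u n\<close>. With \<open>cmod \<zeta>\<close> at least 1/2 the
      constant is 4.\<close>
    have comp: "g m \<le> 4 * u n" if n: "n \<in> {1..N}" and m: "n = k + m \<or> k = n + m" for n m
    proof -
      have eq: "cmod (\<zeta> * a ^ n - \<zeta> * a ^ k) = cmod \<zeta> * g m"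
      proof -
        have "cmod (a ^ n - a ^ k) = g m"
          using m
        proof
          assume "n = k + m"
          then have "a ^ n - a ^ k = - (a ^ k * (1 - a ^ m))" by (simp add: power_add algebra_simps)
          then show ?thesis by (simp add: norm_mult norm_power a g_def)
        next
          assume "k = n + m"
          then have "a ^ n - a ^ k = a ^ n * (1 - a ^ m)" by (simp add: power_add algebra_simps)
          then show ?thesis by (simp add: norm_mult norm_power a g_def)
        qed
        then show ?thesis by (simp add: norm_mult flip: right_diff_distrib)
      qed
      have "cmod \<zeta> * g m \<le> u n + u k"
        unfolding eq[symmetric] u_def using norm_triangle_ineq4[of "1 - \<zeta> * a ^ k" "1 - \<zeta> * a ^ n"]
        by simp
      also have "\<dots> \<le> 2 * u n" using k(2)[OF n] by simp
      finally have "1/2 * g m \<le> 2 * u n" using mult_right_mono[OF \<zeta>2, of "g m"] by (simp add: g_def)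
      then show ?thesis by simp
    qed
    have step: "max 1 (e / u n) \<le> max 1 (4 * e / g m)"
      if "n \<in> {1..N}" "n = k + m \<or> k = n + m" "m \<ge> 1" for n m
    proof -
      have "g m > 0" using nz[of m] that by (simp add: g_def)
      moreover have "e * g m \<le> e * (4 * u n)" using comp[of n m] that e by (intro mult_left_mono) auto
      ultimately have "e / u n \<le> 4 * e / g m" using upos[of n] that by (simp add: field_simps)
      then show ?thesis by simp
    qed
    have low: "(\<Prod>n=1..<k. max 1 (e / u n)) \<le> exp (\<eta> * real (k - 1))"
    proof -
      have "(\<Prod>n=1..<k. max 1 (e / u n)) \<le> (\<Prod>n=1..<k. max 1 (4 * e / g (k - n)))"
        using k(1) by (intro prod_mono conjI step) auto
      also have "\<dots> = (\<Prod>m=1..k-1. max 1 (4 * e / g m))"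
        by (rule prod.reindex_bij_witness[of _ "\<lambda>m. k - m" "\<lambda>m. k - m"]) auto
      also have "\<dots> \<le> exp (\<eta> * real (k - 1))" using G[of "k - 1"] by (simp add: g_def)
      finally show ?thesis .
    qed
    have high: "(\<Prod>n=Suc k..N. max 1 (e / u n)) \<le> exp (\<eta> * real (N - k))"
    proof -
      have "(\<Prod>n=Suc k..N. max 1 (e / u n)) \<le> (\<Prod>n=Suc k..N. max 1 (4 * e / g (n - k)))"
        using k(1) by (intro prod_mono conjI step) auto
      also have "\<dots> = (\<Prod>m=1..N-k. max 1 (4 * e / g m))"
        by (rule prod.reindex_bij_witness[of _ "\<lambda>m. k + m" "\<lambda>m. m - k"]) auto
      also have "\<dots> \<le> exp (\<eta> * real (N - k))" using G[of "N - k"] by (simp add: g_def)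
      finally show ?thesis .
    qed
    \<comment> \<open>The minimal divisor is the only one estimated through
      \<open>d\<close>.\<close>
    have mid: "max 1 (e / u k) \<le> (1 + 1 / d) * (1 + real N) ^ T"
    proof -
      have "u k > 0" using upos k by auto
      have "e / u k \<le> 1 / (d / real k ^ T)"
        using w[of k] k d e by (intro frac_le) (auto simp: u_def)
      also have "\<dots> = 1 / d * real k ^ T" by simp
      also have "\<dots> \<le> (1 + 1 / d) * (1 + real N) ^ T"
        using d k by (intro mult_mono power_mono) auto
      finally show ?thesis using C1 by simp
    qed
    have "{1..N} = {1..<k} \<union> insert k {Suc k..N}" using k by auto
    then have "(\<Prod>n=1..N. max 1 (e / u n)) =
        (\<Prod>n=1..<k. max 1 (e / u n)) * (max 1 (e / u k) * (\<Prod>n=Suc k..N. max 1 (e / u n)))"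
      by (subst \<open>{1..N} = _\<close>, subst prod.union_disjoint) auto
    also have "\<dots> \<le> exp (\<eta> * real (k - 1)) * (((1 + 1 / d) * (1 + real N) ^ T) * exp (\<eta> * real (N - k)))"
      using low mid high d by (intro mult_mono) (auto intro!: prod_nonneg mult_nonneg_nonneg)
    also have "\<dots> = (1 + 1 / d) * (1 + real N) ^ T * exp (\<eta> * real (k - 1) + \<eta> * real (N - k))"
      by (simp add: exp_add)
    also have "\<dots> \<le> (1 + 1 / d) * (1 + real N) ^ T * exp (\<eta> * real N)"
    proof -
      have "\<eta> * real (k - 1) + \<eta> * real (N - k) = \<eta> * real (N - 1)"
        using k by (simp add: of_nat_diff algebra_simps)
      also have "\<dots> \<le> \<eta> * real N" using \<eta> by (intro mult_left_mono) auto
      finally show ?thesis using d by (intro mult_left_mono) auto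
    qed
    finally show ?thesis by (simp add: u_def)
  qed
qed

text \<open>The two divisor families are separated by
  \<open>max 1 (e * e / (u * v)) \<le> max 1 (e / u) * max 1 (e / v)\<close>. The rate is split in
  thirds: one for each family and one to absorb the polynomial factor. The order of quantifiers is
  the point: \<open>e\<close> is fixed before \<open>\<zeta>\<close> and \<open>d\<close>, which
  influence only \<open>C\<close>, so the coupling threshold will be uniform in the energy.\<close>

lemma prod_bloch_divisors_le:
  fixes a :: complex and c \<eta> :: real
  assumes a: "cmod a = 1" and c: "c > 0" and \<eta>: "\<eta> > 0"
    and dc: "\<And>n::nat. n \<ge> 1 \<Longrightarrow> c / real n ^ T \<le> cmod (1 - a ^ n)"
  shows "\<exists>e>0. \<forall>\<zeta> d. cmod \<zeta> \<le> 1 \<longrightarrow> d > 0 \<longrightarrow>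
      (\<forall>n::nat. n \<ge> 1 \<longrightarrow> d / real n ^ T \<le> cmod (1 - \<zeta> * a ^ n)) \<longrightarrow>
      (\<exists>C. \<forall>N. (\<Prod>n=1..N. max 1 (e / (cmod (1 - a ^ n) * cmod (1 - \<zeta> * a ^ n)))) \<le> C * exp (\<eta> * real N))"
proof -
  define \<eta>' where "\<eta>' = \<eta> / 3"
  have \<eta>': "\<eta>' > 0" using \<eta> by (simp add: \<eta>'_def)
  obtain e0 where e0: "e0 > 0"
    and G: "\<And>e' N. e' \<in> {0<..e0} \<Longrightarrow> (\<Prod>n=1..N. max 1 (e' / cmod (1 - a ^ n))) \<le> exp (\<eta>' * real N)"
    using prod_small_divisors_le[OF a c \<eta>' dc] by blast
  define e where "e = min (1/2) (e0 / 4)"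
  have e: "0 < e" "e \<le> 1/2" "4 * e \<in> {0<..e0}" "e \<in> {0<..e0}" using e0 by (auto simp: e_def)
  have nz: "a ^ n \<noteq> 1" if "n \<ge> 1" for n
    using less_le_trans[OF divide_pos_pos dc[OF that]] c that by auto
  show ?thesis
  proof (rule exI[of _ "e * e"], intro conjI allI impI)
    fix \<zeta> :: complex and d :: real
    assume \<zeta>: "cmod \<zeta> \<le> 1" and d: "d > 0"
      and w: "\<forall>n::nat. n \<ge> 1 \<longrightarrow> d / real n ^ T \<le> cmod (1 - \<zeta> * a ^ n)"
    \<comment> \<open>Chosen so that the \<open>T\<close>-th power of
      \<open>1 + \<delta> * N \<le> exp (\<delta> * N)\<close> grows at a rate of at most
      \<open>\<eta>'\<close>; the 1 covers \<open>T = 0\<close>.\<close>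
    define \<delta> where "\<delta> = \<eta>' / (real T + 1)"
    have \<delta>: "\<delta> > 0" "real T * \<delta> \<le> \<eta>'" using \<eta>' by (auto simp: \<delta>_def field_simps)
    have poly: "(1 + real N) ^ T \<le> (1 + 1 / \<delta>) ^ T * exp (\<eta>' * real N)" for N
    proof -
      have "1 + real N \<le> (1 + 1 / \<delta>) * (1 + \<delta> * real N)" using \<delta> by (simp add: field_simps)
      also have "\<dots> \<le> (1 + 1 / \<delta>) * exp (\<delta> * real N)"
        using \<delta> by (intro mult_left_mono) (auto simp: exp_ge_add_one_self)
      finally have "(1 + real N) ^ T \<le> ((1 + 1 / \<delta>) * exp (\<delta> * real N)) ^ T" by (rule power_mono) simp
      also have "\<dots> = (1 + 1 / \<delta>) ^ T * exp (real T * \<delta> * real N)"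
        by (simp add: power_mult_distrib exp_of_nat_mult[symmetric] mult.assoc)
      also have "\<dots> \<le> (1 + 1 / \<delta>) ^ T * exp (\<eta>' * real N)"
        using \<delta> by (intro mult_left_mono) (auto intro: mult_right_mono)
      finally show ?thesis .
    qed
    show "\<exists>C. \<forall>N. (\<Prod>n=1..N. max 1 (e * e / (cmod (1 - a ^ n) * cmod (1 - \<zeta> * a ^ n)))) \<le> C * exp (\<eta> * real N)"
    proof (rule exI, rule allI)
      fix N
      have fac: "max 1 (e * e / (u * v)) \<le> max 1 (e / u) * max 1 (e / v)" if "u \<ge> 0" "v \<ge> 0" for u v :: real
      proof -
        have "e / u * (e / v) \<le> max 1 (e / u) * max 1 (e / v)" using that e by (intro mult_mono) auto
        moreover have "1 * 1 \<le> max 1 (e / u) * max 1 (e / v)" by (intro mult_mono) auto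
        ultimately show ?thesis by simp
      qed
      have "(\<Prod>n=1..N. max 1 (e * e / (cmod (1 - a ^ n) * cmod (1 - \<zeta> * a ^ n))))
          \<le> (\<Prod>n=1..N. max 1 (e / cmod (1 - a ^ n)) * max 1 (e / cmod (1 - \<zeta> * a ^ n)))"
        by (intro prod_mono conjI fac) auto
      also have "\<dots> = (\<Prod>n=1..N. max 1 (e / cmod (1 - a ^ n))) * (\<Prod>n=1..N. max 1 (e / cmod (1 - \<zeta> * a ^ n)))"
        by (rule prod.distrib)
      also have "\<dots> \<le> exp (\<eta>' * real N) * ((1 + 1 / d) * (1 + real N) ^ T * exp (\<eta>' * real N))"
        using G[OF e(4)] prod_shifted_divisors_le[OF a \<zeta> d e(1,2) G[OF e(3)] less_imp_le[OF \<eta>'] nz, of T N] w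
        by (intro mult_mono) (auto intro!: prod_nonneg)
      also have "\<dots> \<le> exp (\<eta>' * real N) * ((1 + 1 / d) * ((1 + 1 / \<delta>) ^ T * exp (\<eta>' * real N)) * exp (\<eta>' * real N))"
        using d poly[of N] by (intro mult_left_mono mult_right_mono) auto
      also have "\<dots> = ((1 + 1 / d) * (1 + 1 / \<delta>) ^ T) * exp (\<eta>' * real N + \<eta>' * real N + \<eta>' * real N)"
        by (simp only: exp_add mult_ac)
      also have "\<eta>' * real N + \<eta>' * real N + \<eta>' * real N = \<eta> * real N" by (simp add: \<eta>'_def)
      finally show "(\<Prod>n=1..N. max 1 (e * e / (cmod (1 - a ^ n) * cmod (1 - \<zeta> * a ^ n))))
          \<le> ((1 + 1 / d) * (1 + 1 / \<delta>) ^ T) * exp (\<eta> * real N)" .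
    qed
  qed (use e in auto)
qed

section \<open>Bloch waves\<close>

fun triangular_solution :: "(nat \<Rightarrow> complex) \<Rightarrow> complex fps \<Rightarrow> nat \<Rightarrow> complex" where
  "triangular_solution D \<beta> k =
     (if k = 0 then 1 else - (\<Sum>l<k. \<beta> $ (k - l) * triangular_solution D \<beta> l) / D k)"

declare triangular_solution.simps [simp del]

lemma triangular_solution_0 [simp]: "triangular_solution D \<beta> 0 = 1"
  by (subst triangular_solution.simps) simp

text \<open>Forward substitution. The equation at \<open>k = 0\<close> reads 0 = 0, which leaves the
  coefficient 0 free for the normalisation to 1.\<close>

lemma triangular_solution_eq:
  assumes "\<And>k. k \<ge> 1 \<Longrightarrow> D k \<noteq> 0" "D 0 = 0" "\<beta> $ 0 = 0"
  shows "D k * triangular_solution D \<beta> k + (\<beta> * Abs_fps (triangular_solution D \<beta>)) $ k = 0"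
proof (cases "k = 0")
  case False
  have "(\<beta> * Abs_fps (triangular_solution D \<beta>)) $ k = (\<Sum>l\<le>k. \<beta> $ (k - l) * triangular_solution D \<beta> l)"
    unfolding mult.commute[of \<beta>] fps_mult_nth atLeast0AtMost by (simp add: mult.commute)
  also have "\<dots> = (\<Sum>l<k. \<beta> $ (k - l) * triangular_solution D \<beta> l)"
    using assms(3) by (simp flip: lessThan_Suc_atMost)
  finally show ?thesis
    using assms(1)[of k] False by (simp add: triangular_solution.simps[of D \<beta> k])
qed (use assms in simp)

text \<open>Since the recursion is triangular, each small divisor enters the estimate at most once.\<close>

lemma triangular_solution_bound:
  fixes D :: "nat \<Rightarrow> complex" and h e :: real
  assumes \<beta>: "summable (\<lambda>k. cmod (\<beta> $ k) * exp (h * real k))"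
      "(\<Sum>k. cmod (\<beta> $ k) * exp (h * real k)) \<le> e"
    and D: "\<And>k. k \<ge> 1 \<Longrightarrow> 0 < \<delta> k" "\<And>k. k \<ge> 1 \<Longrightarrow> \<delta> k \<le> cmod (D k)"
  shows "cmod (triangular_solution D \<beta> k) * exp (h * real k) \<le> (\<Prod>j=1..k. max 1 (e / \<delta> j))"
proof (induction k rule: less_induct)
  case (less k)
  define Q where "Q k = (\<Prod>j=1..k. max 1 (e / \<delta> j))" for k :: nat
  have Qmono: "Q l \<le> Q k" if "l \<le> k" for l k
    unfolding Q_def using that by (intro prod_mono2) auto
  have Q1: "1 \<le> Q k" for k unfolding Q_def by (intro prod_ge_1) auto
  show ?case
  proof (cases k)
    case 0
    then show ?thesis by simp
  next
    case (Suc k')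
    then have "k \<noteq> 0" by simp
    define b where "b j = cmod (\<beta> $ j) * exp (h * real j)" for j
    have bsum: "(\<Sum>l<k. b (k - l)) \<le> e"
    proof -
      have "(\<Sum>l<k. b (k - l)) = (\<Sum>j\<in>{1..k}. b j)"
        by (rule sum.reindex_bij_witness[of _ "\<lambda>j. k - j" "\<lambda>j. k - j"]) auto
      also have "\<dots> \<le> (\<Sum>j. b j)" using \<beta>(1) by (intro sum_le_suminf) (auto simp: b_def)
      finally show ?thesis using \<beta>(2) by (simp add: b_def)
    qed
    have e: "e \<ge> 0" by (rule order_trans[OF _ bsum]) (auto simp: b_def intro!: sum_nonneg)
    have Dk: "0 < cmod (D k)" "0 < \<delta> k" using D[of k] Suc by auto
    have "cmod (triangular_solution D \<beta> k) * exp (h * real k)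
        = cmod (\<Sum>l<k. \<beta> $ (k - l) * triangular_solution D \<beta> l) * exp (h * real k) / cmod (D k)"
      using \<open>k \<noteq> 0\<close> by (simp add: triangular_solution.simps[of D \<beta> k] norm_divide)
    \<comment> \<open>All earlier coefficients are bounded by the one value \<open>Q k'\<close> with
      \<open>k' = k - 1\<close>, so that step \<open>k\<close> multiplies the bound just by
      \<open>max 1 (e / \<delta> k)\<close>. The weight \<open>exp (h * k)\<close> splits along
      \<open>k = (k - l) + l\<close>.\<close>
    also have "\<dots> \<le> (\<Sum>l<k. b (k - l) * Q k') / cmod (D k)"
    proof (rule divide_right_mono)
      have "cmod (\<Sum>l<k. \<beta> $ (k - l) * triangular_solution D \<beta> l) * exp (h * real k)
          \<le> (\<Sum>l<k. cmod (\<beta> $ (k - l) * triangular_solution D \<beta> l)) * exp (h * real k)"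
        by (intro mult_right_mono norm_sum) auto
      also have "\<dots> = (\<Sum>l<k. b (k - l) * (cmod (triangular_solution D \<beta> l) * exp (h * real l)))"
        unfolding sum_distrib_right
      proof (intro sum.cong refl)
        fix l assume "l \<in> {..<k}"
        then have "exp (h * real k) = exp (h * real (k - l)) * exp (h * real l)"
          by (simp add: of_nat_diff algebra_simps flip: exp_add)
        then show "cmod (\<beta> $ (k - l) * triangular_solution D \<beta> l) * exp (h * real k)
            = b (k - l) * (cmod (triangular_solution D \<beta> l) * exp (h * real l))"
          by (simp add: b_def norm_mult)
      qed
      also have "\<dots> \<le> (\<Sum>l<k. b (k - l) * Q k')"
      proof (intro sum_mono mult_left_mono)
        fix l assume "l \<in> {..<k}"
        then show "cmod (triangular_solution D \<beta> l) * exp (h * real l) \<le> Q k'"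
          using less.IH[of l] Qmono[of l k'] Suc unfolding Q_def by fastforce
      qed (auto simp: b_def)
      finally show "cmod (\<Sum>l<k. \<beta> $ (k - l) * triangular_solution D \<beta> l) * exp (h * real k)
          \<le> (\<Sum>l<k. b (k - l) * Q k')" .
    qed auto
    also have "\<dots> \<le> e * Q k' / cmod (D k)"
      using bsum Q1[of k'] by (intro divide_right_mono) (auto simp flip: sum_distrib_right intro: mult_right_mono)
    also have "\<dots> \<le> e * Q k' / \<delta> k"
      using Dk D(2)[of k] Suc e Q1[of k'] by (intro divide_left_mono mult_nonneg_nonneg mult_pos_pos) auto
    also have "\<dots> \<le> Q k' * max 1 (e / \<delta> k)"
      using Q1[of k'] by (simp add: mult.commute[of e] mult_left_mono flip: times_divide_eq_right)
    also have "\<dots> = (\<Prod>j=1..k. max 1 (e / \<delta> j))" by (simp add: Suc Q_def)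
    finally show ?thesis .
  qed
qed

text \<open>The coefficients of a Bloch wave \<open>z\<^sup>n (\<Sum>k. P\<^sub>k w\<^sub>n\<^sup>k)\<close>, where \<open>w\<^sub>n = exp (\<i> (x + n \<alpha>))\<close> and
  \<open>a = exp (\<i> \<alpha>)\<close>, for the energy \<open>z + 1 / z\<close> and the potential \<open>\<Sum>k. \<beta>\<^sub>k w\<^sub>n\<^sup>k\<close>.\<close>

definition bloch_coeffs :: "complex \<Rightarrow> complex \<Rightarrow> complex fps \<Rightarrow> complex fps \<Rightarrow> bool" where
  "bloch_coeffs a z \<beta> P \<longleftrightarrow> P $ 0 = 1 \<and> summable (\<lambda>k. cmod (P $ k)) \<and>
     (\<forall>k. (z * a ^ k + inverse z * inverse a ^ k - z - inverse z) * P $ k + (\<beta> * P) $ k = 0)"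

text \<open>The diagonal entry factors as
  \<open>(1 - a ^ k) * (1 - z\<^sup>2 * a ^ k) / (z * a ^ k)\<close>, of modulus at least the
  product of the two divisors. Divisor products are allowed to grow at rate \<open>h / 2\<close>;
  against the weight \<open>exp (h * k)\<close> this leaves decay at rate \<open>h / 2\<close> for
  the coefficients.\<close>

lemma bloch_coeffs_exist:
  fixes a :: complex and c h :: real
  assumes a: "cmod a = 1" and c: "c > 0" and h: "h > 0"
    and dc: "\<And>n::nat. n \<ge> 1 \<Longrightarrow> c / real n ^ T \<le> cmod (1 - a ^ n)"
  shows "\<exists>e>0. \<forall>z d \<beta>. z \<noteq> 0 \<longrightarrow> cmod z \<le> 1 \<longrightarrow> d > 0 \<longrightarrow>
      (\<forall>n::nat. n \<ge> 1 \<longrightarrow> d / real n ^ T \<le> cmod (1 - z\<^sup>2 * a ^ n)) \<longrightarrow>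
      \<beta> $ 0 = 0 \<longrightarrow> summable (\<lambda>k. cmod (\<beta> $ k) * exp (h * real k)) \<longrightarrow>
      (\<Sum>k. cmod (\<beta> $ k) * exp (h * real k)) \<le> e \<longrightarrow> (\<exists>P. bloch_coeffs a z \<beta> P)"
proof -
  have h2: "h / 2 > 0" using h by simp
  obtain e where e: "e > 0" and bound: "\<And>\<zeta> d. cmod \<zeta> \<le> 1 \<Longrightarrow> d > 0 \<Longrightarrow>
      (\<And>n::nat. n \<ge> 1 \<Longrightarrow> d / real n ^ T \<le> cmod (1 - \<zeta> * a ^ n)) \<Longrightarrow>
      (\<exists>C. \<forall>N. (\<Prod>n=1..N. max 1 (e / (cmod (1 - a ^ n) * cmod (1 - \<zeta> * a ^ n)))) \<le> C * exp (h / 2 * real N))"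
    using prod_bloch_divisors_le[OF a c h2 dc] by blast
  have a0: "a \<noteq> 0" using a by auto
  show ?thesis
  proof (intro exI[of _ e] conjI allI impI e)
    fix z :: complex and d :: real and \<beta> :: "complex fps"
    assume z: "z \<noteq> 0" "cmod z \<le> 1" and d: "d > 0"
      and w: "\<forall>n::nat. n \<ge> 1 \<longrightarrow> d / real n ^ T \<le> cmod (1 - z\<^sup>2 * a ^ n)"
      and \<beta>: "\<beta> $ 0 = 0" "summable (\<lambda>k. cmod (\<beta> $ k) * exp (h * real k))"
        "(\<Sum>k. cmod (\<beta> $ k) * exp (h * real k)) \<le> e"
    define D where "D k = z * a ^ k + inverse z * inverse a ^ k - z - inverse z" for k :: nat
    define \<delta> where "\<delta> k = cmod (1 - a ^ k) * cmod (1 - z\<^sup>2 * a ^ k)" for k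
    define p where "p = triangular_solution D \<beta>"
    have Dfac: "D k = (1 - a ^ k) * (1 - z\<^sup>2 * a ^ k) * inverse z * inverse a ^ k" for k
      using z a0 by (simp add: D_def field_simps power2_eq_square)
    have \<delta>pos: "0 < \<delta> k" if "k \<ge> 1" for k
      using less_le_trans[OF divide_pos_pos dc[OF that]] less_le_trans[OF divide_pos_pos w[rule_format, OF that]]
        c d that unfolding \<delta>_def by (intro mult_pos_pos) auto
    have D\<delta>: "\<delta> k \<le> cmod (D k)" for k
    proof -
      have "cmod (D k) = \<delta> k * inverse (cmod z)"
        by (simp add: Dfac \<delta>_def norm_mult norm_power norm_inverse a)
      moreover have "1 \<le> inverse (cmod z)" using z by (simp add: one_le_inverse)
      ultimately show ?thesis
        using mult_left_mono[of 1 "inverse (cmod z)" "\<delta> k"] by (simp add: \<delta>_def)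
    qed
    have "cmod (z\<^sup>2) \<le> 1" using z by (simp add: norm_power power_le_one)
    then obtain C where C: "\<And>N. (\<Prod>n=1..N. max 1 (e / \<delta> n)) \<le> C * exp (h / 2 * real N)"
      using bound[of "z\<^sup>2" d] d w unfolding \<delta>_def by blast
    have pk: "cmod (p k) \<le> C * exp (- (h / 2)) ^ k" for k
    proof -
      have "cmod (p k) * exp (h * real k) \<le> C * exp (h / 2 * real k)"
        using triangular_solution_bound[OF \<beta>(2,3), of \<delta> D k, OF \<delta>pos D\<delta>] C[of k]
        unfolding p_def by linarith
      then have "cmod (p k) * exp (h * real k) * exp (- (h * real k)) \<le> C * exp (h / 2 * real k) * exp (- (h * real k))"
        by (rule mult_right_mono) simp
      then show ?thesis
        by (simp add: mult.assoc exp_of_nat_mult[symmetric] algebra_simps flip: exp_add)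
    qed
    have "summable (\<lambda>k. C * exp (- (h / 2)) ^ k)" using h by (intro summable_mult summable_geometric) simp
    then have "summable (\<lambda>k. cmod (p k))"
      by (rule summable_comparison_test') (use pk in auto)
    moreover have "D k * p k + (\<beta> * Abs_fps p) $ k = 0" for k
      unfolding p_def
    proof (rule triangular_solution_eq)
      show "D k \<noteq> 0" if "k \<ge> 1" for k using \<delta>pos[OF that] D\<delta>[of k] by auto
    qed (use \<beta> in \<open>auto simp: D_def\<close>)
    ultimately show "\<exists>P. bloch_coeffs a z \<beta> P"
      by (intro exI[of _ "Abs_fps p"]) (auto simp: bloch_coeffs_def p_def D_def)
  qed
qed

section \<open>Power series on the closed unit disc\<close>

lemma summable_norm_powser_unit_disc:
  fixes f :: "nat \<Rightarrow> complex"
  assumes "summable (\<lambda>k. cmod (f k))" "cmod w \<le> 1"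
  shows "summable (\<lambda>k. cmod (f k * w ^ k))"
proof (rule summable_comparison_test'[OF assms(1)])
  show "norm (cmod (f n * w ^ n)) \<le> cmod (f n)" for n
    using assms(2) by (simp add: norm_mult norm_power mult_left_le power_le_one)
qed

text \<open>The evaluation points lie on the unit circle, and \<open>bloch_coeffs\<close> records
  only absolute summability there, so the Cauchy product is used in place of a radius of
  convergence.\<close>

lemma eval_fps_mult_unit_disc:
  assumes "summable (\<lambda>k. cmod (P $ k))" "summable (\<lambda>k. cmod (Q $ k))" "cmod w \<le> 1"
  shows "(\<lambda>k. (P * Q) $ k * w ^ k) sums (eval_fps P w * eval_fps Q w)"
proof -
  have "(\<lambda>k. \<Sum>i\<le>k. (P $ i * w ^ i) * (Q $ (k - i) * w ^ (k - i))) sums (eval_fps P w * eval_fps Q w)"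
    unfolding eval_fps_def
    by (intro Cauchy_product_sums summable_norm_powser_unit_disc assms)
  moreover have "(\<Sum>i\<le>k. (P $ i * w ^ i) * (Q $ (k - i) * w ^ (k - i))) = (P * Q) $ k * w ^ k" for k
    unfolding fps_mult_nth sum_distrib_right atLeast0AtMost
  proof (intro sum.cong refl)
    fix i assume "i \<in> {..k}"
    then have "w ^ k = w ^ i * w ^ (k - i)" by (simp flip: power_add)
    then show "P $ i * w ^ i * (Q $ (k - i) * w ^ (k - i)) = P $ i * Q $ (k - i) * w ^ k" by simp
  qed
  ultimately show ?thesis by simp
qed

lemma eval_fps_sums_unit_disc:
  assumes "summable (\<lambda>k. cmod (P $ k))" "cmod w \<le> 1"
  shows "(\<lambda>k. P $ k * w ^ k) sums eval_fps P w"
  unfolding eval_fps_def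
  using summable_norm_cancel[OF summable_norm_powser_unit_disc[OF assms]] by (rule summable_sums)

text \<open>Multiply the coefficient equation by \<open>w ^ k\<close> and sum: the dilation of the
  argument by \<open>a\<close> multiplies the \<open>k\<close>-th coefficient by
  \<open>a ^ k\<close>.\<close>

lemma bloch_coeffs_equation:
  assumes P: "bloch_coeffs a z \<beta> P" and \<beta>: "summable (\<lambda>k. cmod (\<beta> $ k))"
    and a: "cmod a = 1" and w: "cmod w \<le> 1"
  shows "z * eval_fps P (a * w) + inverse z * eval_fps P (inverse a * w) + eval_fps \<beta> w * eval_fps P w
       = (z + inverse z) * eval_fps P w"
proof -
  have sP: "summable (\<lambda>k. cmod (P $ k))" using P by (simp add: bloch_coeffs_def)
  have aw: "cmod (a * w) \<le> 1" "cmod (inverse a * w) \<le> 1" using a w by (auto simp: norm_mult norm_inverse)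
  have "(\<lambda>k. z * (P $ k * (a * w) ^ k) + inverse z * (P $ k * (inverse a * w) ^ k) + (\<beta> * P) $ k * w ^ k
        - (z + inverse z) * (P $ k * w ^ k)) sums
      (z * eval_fps P (a * w) + inverse z * eval_fps P (inverse a * w) + eval_fps \<beta> w * eval_fps P w
        - (z + inverse z) * eval_fps P w)"
    by (intro sums_add sums_diff sums_mult eval_fps_sums_unit_disc eval_fps_mult_unit_disc sP \<beta> w aw)
  moreover have "z * (P $ k * (a * w) ^ k) + inverse z * (P $ k * (inverse a * w) ^ k) + (\<beta> * P) $ k * w ^ k
        - (z + inverse z) * (P $ k * w ^ k) = 0" for k
  proof -
    have "((z * a ^ k + inverse z * inverse a ^ k - z - inverse z) * P $ k + (\<beta> * P) $ k) * w ^ k = 0"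
      using P by (simp add: bloch_coeffs_def)
    then show ?thesis by (simp add: power_mult_distrib algebra_simps)
  qed
  ultimately have "(\<lambda>k::nat. 0 :: complex) sums
      (z * eval_fps P (a * w) + inverse z * eval_fps P (inverse a * w) + eval_fps \<beta> w * eval_fps P w
        - (z + inverse z) * eval_fps P w)" by simp
  then show ?thesis using sums_unique2[OF sums_zero] by fastforce
qed

text \<open>The Wronskian is a power series in \<open>w\<close> that is invariant under \<open>w \<mapsto> a w\<close>, hence constant.\<close>

lemma bloch_coeffs_wronskian:
  assumes P: "bloch_coeffs a z \<beta> P" and Q: "bloch_coeffs (inverse a) z \<beta> Q"
    and a: "cmod a = 1" and nz: "\<And>n. n \<ge> 1 \<Longrightarrow> a ^ n \<noteq> 1" and w: "cmod w \<le> 1"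
  shows "inverse z * eval_fps P w * eval_fps Q (a * w) - z * eval_fps P (a * w) * eval_fps Q w
       = inverse z - z"
proof -
  \<comment> \<open>The dilation \<open>w \<mapsto> b * w\<close>, written as a composition so that
    multiplicativity is inherited.\<close>
  define s where "s b F = F oo (fps_const b * fps_X)" for b :: complex and F
  have s_nth: "s b F $ k = b ^ k * F $ k" for b F k by (simp add: s_def)
  have s_mult: "s b (F * G) = s b F * s b G" for b F G
    unfolding s_def by (rule fps_compose_mult_distrib) simp
  have s_diff: "s b (F - G) = s b F - s b G" for b F G by (simp add: fps_eq_iff s_nth algebra_simps)
  have s_const: "s b (fps_const x) = fps_const x" for b x by (auto simp: fps_eq_iff s_nth)
  have a0: "a \<noteq> 0" using a by auto
  have s_inv: "s (inverse a) (s a F) = F" for F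
    using a0 by (simp add: fps_eq_iff s_nth field_simps)
  have sP: "summable (\<lambda>k. cmod (P $ k))" and sQ: "summable (\<lambda>k. cmod (Q $ k))"
    and P0: "P $ 0 = 1" and Q0: "Q $ 0 = 1"
    using P Q by (auto simp: bloch_coeffs_def)
  let ?z = "fps_const z" and ?z' = "fps_const (inverse z)"
  have eqP: "?z * s a P + ?z' * s (inverse a) P = (?z + ?z' - \<beta>) * P"
  proof (rule fps_ext)
    fix k
    have "(z * a ^ k + inverse z * inverse a ^ k - z - inverse z) * P $ k + (\<beta> * P) $ k = 0"
      using P by (simp add: bloch_coeffs_def)
    then show "(?z * s a P + ?z' * s (inverse a) P) $ k = ((?z + ?z' - \<beta>) * P) $ k"
      by (simp add: s_nth algebra_simps)
  qed
  have eqQ: "?z * s (inverse a) Q + ?z' * s a Q = (?z + ?z' - \<beta>) * Q"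
  proof (rule fps_ext)
    fix k
    have "(z * inverse a ^ k + inverse z * inverse (inverse a) ^ k - z - inverse z) * Q $ k + (\<beta> * Q) $ k = 0"
      using Q by (simp add: bloch_coeffs_def)
    then show "(?z * s (inverse a) Q + ?z' * s a Q) $ k = ((?z + ?z' - \<beta>) * Q) $ k"
      by (simp add: s_nth algebra_simps)
  qed
  define F where "F = ?z' * (P * s a Q) - ?z * (s a P * Q)"
  \<comment> \<open>Discrete Green identity: \<open>F\<close> and \<open>s (inverse a) F\<close> are
    the Wronskian at neighbouring sites, and their difference cross-multiplies two equations with
    the same potential and energy.\<close>
  have "F - s (inverse a) F = P * (?z * s (inverse a) Q + ?z' * s a Q) - Q * (?z * s a P + ?z' * s (inverse a) P)"
    unfolding F_def by (simp add: s_diff s_mult s_const s_inv algebra_simps)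
  also have "\<dots> = 0" unfolding eqP eqQ by (simp add: algebra_simps)
  finally have "s (inverse a) F = F" by simp
  then have inv: "F $ k = inverse a ^ k * F $ k" for k
    using s_nth[of "inverse a" F k] by simp
  then have Fk: "F $ k = 0" if "k \<ge> 1" for k
  proof -
    have "inverse a ^ k \<noteq> 1" using nz[OF that] by (simp add: power_inverse)
    moreover have "(1 - inverse a ^ k) * F $ k = 0" using inv[of k] by (simp add: left_diff_distrib)
    ultimately show ?thesis by simp
  qed
  have F0: "F $ 0 = inverse z - z" by (simp add: F_def s_nth P0 Q0)
  have ev: "eval_fps (s a G) w = eval_fps G (a * w)" for G
    by (simp add: eval_fps_def s_nth power_mult_distrib mult_ac)
  have ss: "summable (\<lambda>k. cmod (s a G $ k))" if "summable (\<lambda>k. cmod (G $ k))" for G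
    using that by (simp add: s_nth norm_mult norm_power a)
  have "(\<lambda>k. inverse z * ((P * s a Q) $ k * w ^ k) - z * ((s a P * Q) $ k * w ^ k)) sums
      (inverse z * (eval_fps P w * eval_fps (s a Q) w) - z * (eval_fps (s a P) w * eval_fps Q w))"
    by (intro sums_diff sums_mult eval_fps_mult_unit_disc ss sP sQ w)
  moreover have "F $ k * w ^ k = inverse z * ((P * s a Q) $ k * w ^ k) - z * ((s a P * Q) $ k * w ^ k)" for k
    by (simp add: F_def left_diff_distrib mult.assoc)
  ultimately have "(\<lambda>k. F $ k * w ^ k) sums
      (inverse z * eval_fps P w * eval_fps Q (a * w) - z * eval_fps P (a * w) * eval_fps Q w)"
    by (simp add: ev mult.assoc)
  moreover have "(\<lambda>k. F $ k * w ^ k) sums (F $ 0)"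
    using sums_finite[of "{0}" "\<lambda>k. F $ k * w ^ k"] Fk by (simp add: Suc_le_eq)
  ultimately show ?thesis using F0 sums_unique2 by metis
qed

section \<open>Resolvent and spectrum from two solutions\<close>

text \<open>An arbitrary potential sequence separates the spectral theory from the quasi-periodic
  structure.\<close>

definition lattice_schroedinger :: "(int \<Rightarrow> complex) \<Rightarrow> (int \<Rightarrow> complex) \<Rightarrow> int \<Rightarrow> complex" where
  "lattice_schroedinger V \<psi> = (\<lambda>n. \<psi> (n + 1) + \<psi> (n - 1) + V n * \<psi> n)"

lemma bij_plus_const: "bij (\<lambda>n. n + c :: int)"
  by (rule bij_betwI[of _ _ _ "\<lambda>n. n - c"]) auto

lemma bij_const_minus: "bij (\<lambda>n. c - n :: int)"
  by (rule bij_betwI[of _ _ _ "\<lambda>n. c - n"]) auto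

lemma has_sum_shift: "((\<lambda>n. f (n + c)) has_sum S) UNIV \<longleftrightarrow> (f has_sum S) (UNIV :: int set)"
  using has_sum_reindex_bij_betw[OF bij_plus_const] .

lemma summable_on_geometric_abs:
  fixes r :: real
  assumes "0 < r" "r < 1"
  shows "(\<lambda>n::int. r ^ nat \<bar>n\<bar>) summable_on UNIV"
proof -
  have g: "(\<lambda>k::nat. r ^ k) summable_on UNIV"
    using assms by (intro summable_nonneg_imp_summable_on) (auto intro: summable_geometric)
  have "(\<lambda>n::int. r ^ nat \<bar>n\<bar>) summable_on range int"
    by (subst summable_on_reindex) (use g in \<open>auto simp: o_def\<close>)
  moreover have "(\<lambda>n::int. r ^ nat \<bar>n\<bar>) summable_on range (\<lambda>k. - int k)"
    by (subst summable_on_reindex) (use g in \<open>auto simp: o_def inj_on_def\<close>)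
  ultimately have "(\<lambda>n::int. r ^ nat \<bar>n\<bar>) summable_on (range int \<union> range (\<lambda>k. - int k))"
    by (rule summable_on_union)
  moreover have "range int \<union> range (\<lambda>k. - int k) = UNIV"
    by (auto, metis int_cases2 rangeI)
  ultimately show ?thesis by simp
qed

lemma l2_bounded: "\<psi> \<in> l2 \<Longrightarrow> \<exists>B. \<forall>n. cmod (\<psi> n) \<le> B"
proof -
  assume \<psi>: "\<psi> \<in> l2"
  have "(cmod (\<psi> n))\<^sup>2 \<le> (\<Sum>\<^sub>\<infinity>n. (cmod (\<psi> n))\<^sup>2)" for n
    using finite_sum_le_infsum[of "\<lambda>n. (cmod (\<psi> n))\<^sup>2" UNIV "{n}"] \<psi> by (simp add: l2_def)
  then have "cmod (\<psi> n) \<le> sqrt (\<Sum>\<^sub>\<infinity>n. (cmod (\<psi> n))\<^sup>2)" for n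
    by (rule real_le_rsqrt)
  then show ?thesis by blast
qed

text \<open>Cauchy--Schwarz, read off from \<open>0 \<le> \<Sum>n. k n (f n - t)\<^sup>2\<close> with \<open>t\<close> the weighted mean of \<open>f\<close>.\<close>

lemma has_sum_weighted_square_le:
  fixes k f :: "'a \<Rightarrow> real"
  assumes "(k has_sum A) X" "((\<lambda>n. k n * f n) has_sum S) X" "((\<lambda>n. k n * (f n)\<^sup>2) has_sum Q) X"
    and "\<And>n. n \<in> X \<Longrightarrow> k n \<ge> 0" "A > 0"
  shows "S\<^sup>2 \<le> A * Q"
proof -
  define t where "t = S / A"
  have "((\<lambda>n. k n * (f n)\<^sup>2 + (- 2 * t) * (k n * f n) + t\<^sup>2 * k n) has_sum (Q + (- 2 * t) * S + t\<^sup>2 * A)) X"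
    by (intro has_sum_add has_sum_cmult_right assms)
  moreover have "k n * (f n)\<^sup>2 + (- 2 * t) * (k n * f n) + t\<^sup>2 * k n = k n * (f n - t)\<^sup>2" for n
    by (simp add: power2_eq_square algebra_simps)
  ultimately have "((\<lambda>n. k n * (f n - t)\<^sup>2) has_sum (Q + (- 2 * t) * S + t\<^sup>2 * A)) X"
    by (simp only:)
  then have "0 \<le> Q + (- 2 * t) * S + t\<^sup>2 * A"
    by (rule has_sum_nonneg) (simp add: assms(4))
  also have "\<dots> = Q - S\<^sup>2 / A" using assms(5) by (simp add: t_def power2_eq_square)
  finally show ?thesis using assms(5) by (simp add: pos_divide_le_eq mult.commute)
qed

text \<open>The majorant \<open>k\<close> is symmetric and all its rows have the same sum
  \<open>A\<close>. Weighted Cauchy--Schwarz bounds the square of each output entry by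
  \<open>A\<close> times a weighted sum of \<open>(cmod (\<psi> n))\<^sup>2\<close>; summing over
  the output index first gives another \<open>A\<close>, so the operator norm is at most
  \<open>A\<close>.\<close>

lemma schur_test:
  fixes G :: "int \<Rightarrow> int \<Rightarrow> complex" and r K :: real
  assumes r: "0 < r" "r < 1" and K: "K > 0"
    and G: "\<And>m n. cmod (G m n) \<le> K * r ^ nat \<bar>m - n\<bar>"
  shows "\<exists>C. \<forall>\<psi>\<in>l2. (\<lambda>m. \<Sum>\<^sub>\<infinity>n. G m n * \<psi> n) \<in> l2 \<and> l2_norm (\<lambda>m. \<Sum>\<^sub>\<infinity>n. G m n * \<psi> n) \<le> C * l2_norm \<psi>"
proof -
  define k where "k m n = K * r ^ nat \<bar>m - n\<bar>" for m n :: int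
  obtain A where A0: "((\<lambda>n::int. K * r ^ nat \<bar>n\<bar>) has_sum A) UNIV"
    using has_sum_cmult_right[OF has_sum_infsum[OF summable_on_geometric_abs[OF r]]] by blast
  have A: "((\<lambda>n. k m n) has_sum A) UNIV" for m
    unfolding k_def using has_sum_reindex_bij_betw[OF bij_const_minus, of "\<lambda>n. K * r ^ nat \<bar>n\<bar>" m] A0 by simp
  have k_sym: "k m n = k n m" for m n by (simp add: k_def abs_minus_commute)
  have k0: "k m n > 0" for m n using K r by (simp add: k_def)
  have k0': "k m n \<ge> 0" for m n using k0[of m n] by simp
  have Apos: "A > 0"
    using finite_sum_le_has_sum[OF A[of 0], of "{0}"] k0' less_le_trans[OF k0[of 0 0]] by simp
  show ?thesis
  proof (intro exI ballI)
    fix \<psi> assume \<psi>: "\<psi> \<in> l2"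
    define N2 where "N2 = (\<Sum>\<^sub>\<infinity>n. (cmod (\<psi> n))\<^sup>2)"
    have N2: "((\<lambda>n. (cmod (\<psi> n))\<^sup>2) has_sum N2) UNIV" using \<psi> by (simp add: l2_def N2_def)
    obtain B where B: "\<And>n. cmod (\<psi> n) \<le> B" using l2_bounded[OF \<psi>] by blast
    have B0: "B \<ge> 0" using B[of 0] norm_ge_zero order_trans by blast
    \<comment> \<open>The source index comes first: summation over \<open>m\<close> is explicit and
      proves joint summability, after which the order can be exchanged.\<close>
    define f where "f = (\<lambda>(n, m). k m n * (cmod (\<psi> n))\<^sup>2)"
    have fn: "((\<lambda>m. f (n, m)) has_sum (A * (cmod (\<psi> n))\<^sup>2)) UNIV" for n
      unfolding f_def using has_sum_cmult_left[OF A[of n], of "(cmod (\<psi> n))\<^sup>2"] by (simp add: k_sym[of n])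
    have fs: "((\<lambda>n. A * (cmod (\<psi> n))\<^sup>2) has_sum (A * N2)) UNIV" by (intro has_sum_cmult_right N2)
    have "f summable_on UNIV \<times> UNIV"
      by (rule summable_on_SigmaI[OF fn]) (use fs k0' in \<open>auto simp: f_def has_sum_imp_summable\<close>)
    then have "(f has_sum (A * N2)) (UNIV \<times> UNIV)" by (intro has_sum_SigmaI[OF fn fs])
    then have f2: "((\<lambda>(m, n). f (n, m)) has_sum (A * N2)) (UNIV \<times> UNIV)" by (subst (asm) has_sum_swap)
    define Q where "Q m = (\<Sum>\<^sub>\<infinity>n. f (n, m))" for m
    have Qm: "((\<lambda>n. f (n, m)) has_sum Q m) UNIV" for m
      unfolding Q_def using f2 summable_on_SigmaD1[of "\<lambda>m n. f (n, m)" UNIV "\<lambda>_. UNIV" m]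
      by (intro has_sum_infsum) (auto dest: has_sum_imp_summable)
    have Q: "(Q has_sum (A * N2)) UNIV"
      by (rule has_sum_SigmaD[OF f2]) (use Qm in auto)
    define R where "R m = (\<Sum>\<^sub>\<infinity>n. G m n * \<psi> n)" for m
    have R: "(cmod (R m))\<^sup>2 \<le> A * Q m" for m
    proof -
      have s: "(\<lambda>n. k m n * cmod (\<psi> n)) summable_on UNIV"
        by (rule summable_on_comparison_test[OF summable_on_cmult_left[OF has_sum_imp_summable[OF A[of m]], of B]])
          (use k0' B in \<open>auto intro!: mult_left_mono mult_nonneg_nonneg\<close>)
      have bd: "cmod (G m n * \<psi> n) \<le> k m n * cmod (\<psi> n)" for n
        using G[of m n] by (simp add: norm_mult k_def mult_right_mono)
      have "(\<lambda>n. G m n * \<psi> n) summable_on UNIV"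
        by (rule abs_summable_summable[OF Infinite_Sum.abs_summable_on_comparison_test'[OF s bd]])
      then have "cmod (R m) \<le> (\<Sum>\<^sub>\<infinity>n. k m n * cmod (\<psi> n))"
        unfolding R_def by (intro norm_infsum_le[OF has_sum_infsum has_sum_infsum[OF s] bd])
      then have "(cmod (R m))\<^sup>2 \<le> (\<Sum>\<^sub>\<infinity>n. k m n * cmod (\<psi> n))\<^sup>2" by (rule power_mono) simp
      also have "\<dots> \<le> A * Q m"
        using Qm[of m] k0'
        by (intro has_sum_weighted_square_le[OF A[of m] has_sum_infsum[OF s] _ _ Apos]) (auto simp: f_def)
      finally show ?thesis .
    qed
    have AQ: "((\<lambda>m. A * Q m) has_sum (A * (A * N2))) UNIV" by (intro has_sum_cmult_right Q)
    have Rs: "(\<lambda>m. (cmod (R m))\<^sup>2) summable_on UNIV"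
      by (rule summable_on_comparison_test[OF has_sum_imp_summable[OF AQ]]) (use R in auto)
    have "(\<Sum>\<^sub>\<infinity>m. (cmod (R m))\<^sup>2) \<le> A * (A * N2)"
      by (rule has_sum_mono[OF has_sum_infsum[OF Rs] AQ]) (use R in auto)
    then have "l2_norm R \<le> sqrt (A\<^sup>2 * N2)" unfolding l2_norm_def by (simp add: power2_eq_square)
    also have "\<dots> = A * l2_norm \<psi>" using Apos by (simp add: real_sqrt_mult l2_norm_def N2_def)
    finally show "(\<lambda>m. \<Sum>\<^sub>\<infinity>n. G m n * \<psi> n) \<in> l2 \<and> l2_norm (\<lambda>m. \<Sum>\<^sub>\<infinity>n. G m n * \<psi> n) \<le> A * l2_norm \<psi>"
      using Rs unfolding l2_def R_def by simp
  qed
qed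

text \<open>The kernel equation in the first variable makes \<open>R\<close> a right inverse;
  symmetry transfers it to the second variable, where summation by parts makes \<open>R\<close> a
  left inverse.\<close>

lemma green_kernel_resolvent:
  fixes G :: "int \<Rightarrow> int \<Rightarrow> complex" and r K :: real
  assumes r: "0 < r" "r < 1" and K: "K > 0"
    and G: "\<And>m n. cmod (G m n) \<le> K * r ^ nat \<bar>m - n\<bar>"
    and sym: "\<And>m n. G m n = G n m"
    and eq: "\<And>m n. G (m + 1) n + G (m - 1) n + (V m - E) * G m n = of_bool (m = n)"
  shows "E \<in> l2_resolvent_set (lattice_schroedinger V)"
proof -
  define R where "R \<psi> m = (\<Sum>\<^sub>\<infinity>n. G m n * \<psi> n)" for \<psi> m
  have sum: "((\<lambda>n. G m n * \<psi> n) has_sum R \<psi> m) UNIV" if \<psi>: "\<psi> \<in> l2" for \<psi> m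
  proof -
    obtain B where B: "\<And>n. cmod (\<psi> n) \<le> B" using l2_bounded[OF \<psi>] by blast
    have "(\<lambda>n::int. K * r ^ nat \<bar>m - n\<bar>) summable_on UNIV"
      using summable_on_reindex_bij_betw[OF bij_const_minus, of "\<lambda>n. K * r ^ nat \<bar>n\<bar>" m]
        summable_on_cmult_right[OF summable_on_geometric_abs[OF r]] by simp
    then have s: "(\<lambda>n::int. K * r ^ nat \<bar>m - n\<bar> * B) summable_on UNIV" by (rule summable_on_cmult_left)
    have "cmod (G m n * \<psi> n) \<le> K * r ^ nat \<bar>m - n\<bar> * B" for n
      unfolding norm_mult using G B K r by (intro mult_mono) auto
    then have "(\<lambda>n. cmod (G m n * \<psi> n)) summable_on UNIV" by (intro Infinite_Sum.abs_summable_on_comparison_test'[OF s])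
    then show ?thesis unfolding R_def by (rule has_sum_infsum[OF abs_summable_summable])
  qed
  have delta: "((\<lambda>n. of_bool (m = n) * \<psi> n) has_sum \<psi> m) UNIV" for m :: int and \<psi> :: "int \<Rightarrow> complex"
    by (rule has_sum_finite_neutralI[of "{m}"]) auto
  have right: "lattice_schroedinger V (R \<psi>) m - E * R \<psi> m = \<psi> m" if \<psi>: "\<psi> \<in> l2" for \<psi> m
  proof -
    have "((\<lambda>n. G (m + 1) n * \<psi> n + G (m - 1) n * \<psi> n + (V m - E) * (G m n * \<psi> n)) has_sum
        (R \<psi> (m + 1) + R \<psi> (m - 1) + (V m - E) * R \<psi> m)) UNIV"
      by (intro has_sum_add has_sum_cmult_right sum \<psi>)
    moreover have "G (m + 1) n * \<psi> n + G (m - 1) n * \<psi> n + (V m - E) * (G m n * \<psi> n) = of_bool (m = n) * \<psi> n" for n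
      unfolding eq[symmetric] by (simp add: algebra_simps)
    ultimately have "((\<lambda>n. of_bool (m = n) * \<psi> n) has_sum (R \<psi> (m + 1) + R \<psi> (m - 1) + (V m - E) * R \<psi> m)) UNIV"
      by (simp only:)
    then have "R \<psi> (m + 1) + R \<psi> (m - 1) + (V m - E) * R \<psi> m = \<psi> m"
      by (rule has_sum_unique) (rule delta)
    then show ?thesis by (simp add: lattice_schroedinger_def algebra_simps)
  qed
  have left: "R (\<lambda>n. lattice_schroedinger V \<psi> n - E * \<psi> n) m = \<psi> m" if \<psi>: "\<psi> \<in> l2" for \<psi> m
  proof -
    have shift: "((\<lambda>n. G m (n - c) * \<psi> n) has_sum S) UNIV \<longleftrightarrow> ((\<lambda>n. G m n * \<psi> (n + c)) has_sum S) UNIV" for c S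
      using has_sum_shift[of "\<lambda>n. G m (n - c) * \<psi> n" c S] by simp
    have sh: "(\<lambda>n. \<psi> (n + c)) \<in> l2" for c
      using \<psi> has_sum_shift[of "\<lambda>n. (cmod (\<psi> n))\<^sup>2" c] by (auto simp: l2_def summable_on_def)
    have s1: "((\<lambda>n. G m n * \<psi> (n + c)) has_sum R (\<lambda>n. \<psi> (n + c)) m) UNIV" for c
      using sum[OF sh] .
    have G': "((\<lambda>n. G m (n - c) * \<psi> n) has_sum R (\<lambda>n. \<psi> (n + c)) m) UNIV" for c
      using s1 shift by blast
    have kern: "G m (n - 1) * \<psi> n + G m (n - (- 1)) * \<psi> n + (V n - E) * (G m n * \<psi> n) = of_bool (m = n) * \<psi> n" for n
      using eq[of n m] by (simp add: sym[of m] eq_commute[of m n] distrib_right[symmetric] mult.assoc[symmetric] add.commute add.left_commute)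
    \<comment> \<open>No bound on \<open>V\<close> is at hand, so this sum is read off from the
      kernel equation as the delta term minus two convergent sums.\<close>
    have V: "((\<lambda>n. (V n - E) * (G m n * \<psi> n)) has_sum (\<psi> m - (R (\<lambda>n. \<psi> (n + 1)) m + R (\<lambda>n. \<psi> (n + (- 1))) m))) UNIV"
    proof -
      have "((\<lambda>n. of_bool (m = n) * \<psi> n + (- 1) * (G m (n - 1) * \<psi> n + G m (n - (- 1)) * \<psi> n)) has_sum
          (\<psi> m + (- 1) * (R (\<lambda>n. \<psi> (n + 1)) m + R (\<lambda>n. \<psi> (n + (- 1))) m))) UNIV"
        by (intro has_sum_add has_sum_cmult_right delta G')
      then show ?thesis unfolding kern[symmetric] by (simp add: algebra_simps)
    qed
    have "((\<lambda>n. G m n * \<psi> (n + 1) + G m n * \<psi> (n + (- 1)) + (V n - E) * (G m n * \<psi> n)) has_sum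
        (R (\<lambda>n. \<psi> (n + 1)) m + R (\<lambda>n. \<psi> (n + (- 1))) m
          + (\<psi> m - (R (\<lambda>n. \<psi> (n + 1)) m + R (\<lambda>n. \<psi> (n + (- 1))) m)))) UNIV"
      by (intro has_sum_add s1 V)
    then have "((\<lambda>n. G m n * (lattice_schroedinger V \<psi> n - E * \<psi> n)) has_sum \<psi> m) UNIV"
      by (simp add: lattice_schroedinger_def algebra_simps)
    then show ?thesis unfolding R_def by (rule infsumI)
  qed
  have "l2_bounded_op R"
    unfolding l2_bounded_op_def
  proof (intro conjI ballI allI)
    obtain C where C: "\<forall>\<psi>\<in>l2. (\<lambda>m. \<Sum>\<^sub>\<infinity>n. G m n * \<psi> n) \<in> l2 \<and> l2_norm (\<lambda>m. \<Sum>\<^sub>\<infinity>n. G m n * \<psi> n) \<le> C * l2_norm \<psi>"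
      using schur_test[OF r K G] by blast
    then show "\<exists>C. \<forall>\<psi>\<in>l2. l2_norm (R \<psi>) \<le> C * l2_norm \<psi>"
      unfolding R_def[abs_def] by blast
    show "R \<psi> \<in> l2" if "\<psi> \<in> l2" for \<psi>
      using C that unfolding R_def[abs_def] by blast
    show "R (\<lambda>n. \<psi> n + \<phi> n) = (\<lambda>n. R \<psi> n + R \<phi> n)" if "\<psi> \<in> l2" "\<phi> \<in> l2" for \<psi> \<phi>
    proof
      show "R (\<lambda>n. \<psi> n + \<phi> n) m = R \<psi> m + R \<phi> m" for m
        using has_sum_add[OF sum[OF that(1), of m] sum[OF that(2), of m]]
        unfolding R_def by (intro infsumI) (simp add: distrib_left)
    qed
    show "R (\<lambda>n. c * \<psi> n) = (\<lambda>n. c * R \<psi> n)" if "\<psi> \<in> l2" for c \<psi>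
      by (simp add: R_def[abs_def] mult.left_commute[of _ c] infsum_cmult_right')
  qed
  then show ?thesis
    unfolding l2_resolvent_set_def using left right by blast
qed

text \<open>Off the diagonal the kernel inherits the equation of \<open>p\<close> or of
  \<open>q\<close>; on the diagonal the defect is the Wronskian, and the sign in \<open>G\<close>
  turns it into +1. The two growth bounds combine because \<open>max m n - min m n\<close> is the
  distance of \<open>m\<close> and \<open>n\<close>.\<close>

lemma decaying_solutions_resolvent:
  fixes p q :: "int \<Rightarrow> complex" and r K :: real
  assumes r: "0 < r" "r < 1"
    and p: "\<And>n. p (n + 1) + p (n - 1) + V n * p n = E * p n"
    and q: "\<And>n. q (n + 1) + q (n - 1) + V n * q n = E * q n"
    and \<kappa>: "\<And>n. p n * q (n + 1) - p (n + 1) * q n = \<kappa>" "\<kappa> \<noteq> 0"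
    and bd: "\<And>n. cmod (p n) \<le> K * r powi n" "\<And>n. cmod (q n) \<le> K * r powi (- n)"
  shows "E \<in> l2_resolvent_set (lattice_schroedinger V)"
proof -
  define G where "G m n = - (p (max m n) * q (min m n)) / \<kappa>" for m n
  have K: "K \<ge> 0" using order_trans[OF norm_ge_zero bd(1)[of 0]] by simp
  show ?thesis
  proof (rule green_kernel_resolvent[OF r])
    \<comment> \<open>The summand 1 gives positivity without a separate treatment of
      \<open>K = 0\<close>.\<close>
    show "0 < K * K / cmod \<kappa> + 1" using \<kappa>(2) K by (simp add: add_nonneg_pos)
    show "cmod (G m n) \<le> (K * K / cmod \<kappa> + 1) * r ^ nat \<bar>m - n\<bar>" for m n
    proof -
      have "cmod (G m n) = cmod (p (max m n)) * cmod (q (min m n)) / cmod \<kappa>"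
        by (simp add: G_def norm_divide norm_mult)
      also have "\<dots> \<le> (K * r powi (max m n)) * (K * r powi (- min m n)) / cmod \<kappa>"
        using bd K r by (intro divide_right_mono mult_mono) auto
      also have "\<dots> = K * K / cmod \<kappa> * r powi (max m n + - min m n)"
        using r by (subst power_int_add) auto
      also have "max m n + - min m n = int (nat \<bar>m - n\<bar>)" by auto
      also have "K * K / cmod \<kappa> * r powi int (nat \<bar>m - n\<bar>) \<le> (K * K / cmod \<kappa> + 1) * r ^ nat \<bar>m - n\<bar>"
        unfolding power_int_of_nat using r by (simp add: distrib_right)
      finally show ?thesis .
    qed
    show "G m n = G n m" for m n by (simp add: G_def max.commute min.commute)
    show "G (m + 1) n + G (m - 1) n + (V m - E) * G m n = of_bool (m = n)" for m n
    proof -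
      consider "m > n" | "m < n" | "m = n" by linarith
      then show ?thesis
      proof cases
        case 1
        then have mx: "max (m + 1) n = m + 1" "max (m - 1) n = m - 1" "max m n = m"
          "min (m + 1) n = n" "min (m - 1) n = n" "min m n = n" by auto
        have "G (m + 1) n + G (m - 1) n + (V m - E) * G m n
            = - ((p (m + 1) + p (m - 1) + V m * p m - E * p m) * q n) / \<kappa>"
          using \<kappa>(2) unfolding G_def mx by (simp add: field_simps)
        then show ?thesis using 1 p[of m] by simp
      next
        case 2
        then have mx: "max (m + 1) n = n" "max (m - 1) n = n" "max m n = n"
          "min (m + 1) n = m + 1" "min (m - 1) n = m - 1" "min m n = m" by auto
        have "G (m + 1) n + G (m - 1) n + (V m - E) * G m n
            = - (p n * (q (m + 1) + q (m - 1) + V m * q m - E * q m)) / \<kappa>"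
          using \<kappa>(2) unfolding G_def mx by (simp add: field_simps)
        then show ?thesis using 2 q[of m] by simp
      next
        case 3
        then have mx: "max (m + 1) n = n + 1" "max (m - 1) n = n" "max m n = n"
          "min (m + 1) n = n" "min (m - 1) n = n - 1" "min m n = n" by auto
        have "G (m + 1) n + G (m - 1) n + (V m - E) * G m n
            = (p n * q (n + 1) - p (n + 1) * q n
               - p n * (q (n + 1) + q (n - 1) + V n * q n - E * q n)) / \<kappa>"
          using \<kappa>(2) 3 unfolding G_def mx by (simp add: field_simps)
        then show ?thesis using 3 q[of n] \<kappa> by simp
      qed
    qed
  qed
qed

text \<open>Truncating a bounded solution \<open>p\<close> to \<open>{0..<N}\<close> yields approximate eigenvectors, unless \<open>p\<close> is
  square summable at \<open>+\<infinity>\<close>; the latter would force the Wronskian with a bounded solution to vanish.\<close>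

lemma bounded_solutions_away_from_resolvent:
  assumes E0: "E0 \<in> l2_resolvent_set (lattice_schroedinger V)"
  shows "\<exists>\<delta>>0. \<forall>E p q K \<kappa>. (\<forall>n. p (n + 1) + p (n - 1) + V n * p n = E * p n) \<longrightarrow>
     (\<forall>n. p n * q (n + 1) - p (n + 1) * q n = \<kappa>) \<longrightarrow> \<kappa> \<noteq> 0 \<longrightarrow>
     (\<forall>n. cmod (p n) \<le> K) \<longrightarrow> (\<forall>n. cmod (q n) \<le> K) \<longrightarrow> \<delta> \<le> cmod (E - E0)"
proof -
  let ?T = "lattice_schroedinger V"
  obtain R where R: "l2_bounded_op R" "\<And>\<psi>. \<psi> \<in> l2 \<Longrightarrow> R (\<lambda>n. ?T \<psi> n - E0 * \<psi> n) = \<psi>"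
    using E0 unfolding l2_resolvent_set_def by blast
  obtain C0 where C0: "\<And>\<psi>. \<psi> \<in> l2 \<Longrightarrow> l2_norm (R \<psi>) \<le> C0 * l2_norm \<psi>"
    using R(1) unfolding l2_bounded_op_def by blast
  define C where "C = max C0 1"
  have C1: "C > 0" by (simp add: C_def)
  have C2: "l2_norm (R \<psi>) \<le> C * l2_norm \<psi>" if "\<psi> \<in> l2" for \<psi>
  proof -
    have "C0 * l2_norm \<psi> \<le> C * l2_norm \<psi>"
      unfolding C_def by (intro mult_right_mono) (auto simp: l2_norm_def infsum_nonneg)
    with C0[OF that] show ?thesis by linarith
  qed
  note C = C1 C2
  \<comment> \<open>With this radius,
    \<open>4 * C\<^sup>2 * (cmod (E - E0))\<^sup>2 \<le> 1\<close>, and the energy mismatch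
    contributes at most \<open>S / 2\<close>, which is absorbed on the left.\<close>
  show ?thesis
  proof (intro exI[of _ "1 / (2 * C)"] conjI allI impI)
    fix E :: complex and p q :: "int \<Rightarrow> complex" and K :: real and \<kappa> :: complex
    assume p: "\<forall>n. p (n + 1) + p (n - 1) + V n * p n = E * p n"
      and \<kappa>: "\<forall>n. p n * q (n + 1) - p (n + 1) * q n = \<kappa>" "\<kappa> \<noteq> 0"
      and pK: "\<forall>n. cmod (p n) \<le> K" and qK: "\<forall>n. cmod (q n) \<le> K"
    show "1 / (2 * C) \<le> cmod (E - E0)"
    proof (rule ccontr)
      assume "\<not> 1 / (2 * C) \<le> cmod (E - E0)"
      then have "2 * C * cmod (E - E0) \<le> 1" using C by (simp add: field_simps)
      then have small: "4 * C\<^sup>2 * (cmod (E - E0))\<^sup>2 \<le> 1"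
        using power_mono[of "2 * C * cmod (E - E0)" 1 2] C by (simp add: power_mult_distrib)
      have K0: "K \<ge> 0" using pK norm_ge_zero order_trans by blast
      have partial: "(\<Sum>n\<in>{0..<int N}. (cmod (p n))\<^sup>2) \<le> 64 * C\<^sup>2 * K\<^sup>2" for N
      proof -
        define \<phi> where "\<phi> n = (if n \<in> {0..<int N} then p n else 0)" for n
        define \<xi> where "\<xi> n = ?T \<phi> n - E * \<phi> n" for n
        define S where "S = (\<Sum>n\<in>{0..<int N}. (cmod (p n))\<^sup>2)"
        \<comment> \<open>The only sites where the truncation breaks the eigenvalue equation: one on
          each side of both cuts.\<close>
        define J where "J = {-1, 0, int N - 1, int N}"
        have \<xi>0: "\<xi> n = 0" if "n \<notin> J" for n
          using that p[rule_format, of n] by (auto simp: \<xi>_def \<phi>_def J_def lattice_schroedinger_def)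
        have \<phi>K: "cmod (\<phi> n) \<le> K" for n using pK K0 by (simp add: \<phi>_def)
        have \<xi>K: "cmod (\<xi> n) \<le> 2 * K" for n
        proof (cases "n \<in> {0..<int N}")
          case True
          have "\<xi> n = (\<phi> (n + 1) - p (n + 1)) + (\<phi> (n - 1) - p (n - 1))"
            using True p[rule_format, of n] by (simp add: \<xi>_def \<phi>_def lattice_schroedinger_def algebra_simps)
          moreover have "cmod (\<phi> m - p m) \<le> K" for m using pK K0 by (simp add: \<phi>_def)
          ultimately show ?thesis using norm_triangle_le[of "\<phi> (n + 1) - p (n + 1)" "\<phi> (n - 1) - p (n - 1)" "2 * K"]
            by (smt (verit))
        next
          case False
          then have "\<phi> n = 0" by (auto simp: \<phi>_def)
          then have "\<xi> n = \<phi> (n + 1) + \<phi> (n - 1)" by (simp add: \<xi>_def lattice_schroedinger_def)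
          then show ?thesis using norm_triangle_ineq[of "\<phi> (n + 1)" "\<phi> (n - 1)"] \<phi>K[of "n + 1"] \<phi>K[of "n - 1"] by simp
        qed
        have \<phi>s: "((\<lambda>n. (cmod (\<phi> n))\<^sup>2) has_sum S) UNIV"
          by (rule has_sum_finite_neutralI[of "{0..<int N}"]) (auto simp: \<phi>_def S_def)
        have \<xi>s: "((\<lambda>n. (cmod (\<xi> n))\<^sup>2) has_sum (\<Sum>n\<in>J. (cmod (\<xi> n))\<^sup>2)) UNIV"
          by (rule has_sum_finite_neutralI[of J]) (auto simp: \<xi>0 J_def)
        have "(\<Sum>n\<in>J. (cmod (\<xi> n))\<^sup>2) \<le> real (card J) * (2 * K)\<^sup>2"
          using \<xi>K by (intro sum_bounded_above power_mono) auto
        also have "\<dots> \<le> 4 * (2 * K)\<^sup>2"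
        proof (intro mult_right_mono)
          have "card J \<le> 4" unfolding J_def by (intro card_insert_le_m1[THEN order_trans]) (auto intro!: card_insert_le_m1)
          then show "real (card J) \<le> 4" by simp
        qed auto
        finally have \<xi>J: "(\<Sum>n\<in>J. (cmod (\<xi> n))\<^sup>2) \<le> 16 * K\<^sup>2" by (simp add: power_mult_distrib)
        define \<omega> where "\<omega> n = ?T \<phi> n - E0 * \<phi> n" for n
        define b where "b n = 2 * (cmod (\<xi> n))\<^sup>2 + (2 * (cmod (E - E0))\<^sup>2) * (cmod (\<phi> n))\<^sup>2" for n
        have bs: "(b has_sum (2 * (\<Sum>n\<in>J. (cmod (\<xi> n))\<^sup>2) + (2 * (cmod (E - E0))\<^sup>2) * S)) UNIV"
          unfolding b_def[abs_def] by (intro has_sum_add has_sum_cmult_right \<xi>s \<phi>s)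
        have \<omega>b: "(cmod (\<omega> n))\<^sup>2 \<le> b n" for n
        proof -
          have "\<omega> n = \<xi> n + (E - E0) * \<phi> n" by (simp add: \<omega>_def \<xi>_def algebra_simps)
          then have "cmod (\<omega> n) \<le> cmod (\<xi> n) + cmod (E - E0) * cmod (\<phi> n)"
            using norm_triangle_ineq[of "\<xi> n" "(E - E0) * \<phi> n"] by (simp add: norm_mult)
          then have "(cmod (\<omega> n))\<^sup>2 \<le> (cmod (\<xi> n) + cmod (E - E0) * cmod (\<phi> n))\<^sup>2" by (rule power_mono) simp
          also have "\<dots> \<le> 2 * (cmod (\<xi> n))\<^sup>2 + 2 * (cmod (E - E0) * cmod (\<phi> n))\<^sup>2"
            using sum_squares_bound[of "cmod (\<xi> n)" "cmod (E - E0) * cmod (\<phi> n)"] by (simp add: power2_sum)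
          finally show ?thesis by (simp add: b_def power_mult_distrib)
        qed
        have \<omega>s: "(\<lambda>n. (cmod (\<omega> n))\<^sup>2) summable_on UNIV"
          by (rule summable_on_comparison_test[OF has_sum_imp_summable[OF bs]]) (use \<omega>b in auto)
        have \<phi>2: "\<phi> \<in> l2" using \<phi>s by (auto simp: l2_def has_sum_imp_summable)
        have \<omega>2: "\<omega> \<in> l2" using \<omega>s by (simp add: l2_def)
        have "l2_norm \<phi> \<le> C * l2_norm \<omega>" using C(2)[OF \<omega>2] R(2)[OF \<phi>2] by (simp add: \<omega>_def[abs_def])
        then have "(l2_norm \<phi>)\<^sup>2 \<le> (C * l2_norm \<omega>)\<^sup>2"
          by (rule power_mono) (auto simp: l2_norm_def intro!: infsum_nonneg)
        moreover have "(l2_norm \<phi>)\<^sup>2 = S"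
          using infsumI[OF \<phi>s] by (simp add: l2_norm_def S_def sum_nonneg)
        moreover have "(l2_norm \<omega>)\<^sup>2 \<le> 2 * (\<Sum>n\<in>J. (cmod (\<xi> n))\<^sup>2) + (2 * (cmod (E - E0))\<^sup>2) * S"
          using has_sum_mono[OF has_sum_infsum[OF \<omega>s] bs] \<omega>b by (simp add: l2_norm_def infsum_nonneg)
        ultimately have "S \<le> C\<^sup>2 * (2 * (\<Sum>n\<in>J. (cmod (\<xi> n))\<^sup>2) + (2 * (cmod (E - E0))\<^sup>2) * S)"
          using C(1) by (simp add: power_mult_distrib) (meson mult_left_mono order_trans zero_le_power2)
        also have "\<dots> \<le> C\<^sup>2 * (2 * (16 * K\<^sup>2)) + C\<^sup>2 * (2 * (cmod (E - E0))\<^sup>2) * S"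
          using mult_left_mono[OF \<xi>J, of "2 * C\<^sup>2"] by (simp add: algebra_simps)
        also have "\<dots> \<le> C\<^sup>2 * (2 * (16 * K\<^sup>2)) + S / 2"
        proof -
          have "S \<ge> 0" by (simp add: S_def sum_nonneg)
          from mult_right_mono[OF small this] show ?thesis by simp
        qed
        finally show ?thesis by (simp add: S_def)
      qed
      \<comment> \<open>The bound on partial sums does not depend on \<open>N\<close>, hence
        \<open>p\<close> tends to 0 at +infinity; against the bounded \<open>q\<close> the constant
        Wronskian is then 0.\<close>
      have "(\<Sum>n<N. (cmod (p (int n)))\<^sup>2) = (\<Sum>n\<in>{0..<int N}. (cmod (p n))\<^sup>2)" for N
        by (rule sum.reindex_bij_witness[of _ nat int]) auto
      then have "summable (\<lambda>n. (cmod (p (int n)))\<^sup>2)"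
        using partial by (intro bounded_imp_summable[of _ "64 * C\<^sup>2 * K\<^sup>2"])
          (auto, metis lessThan_Suc_atMost)
      then have "(\<lambda>n. (cmod (p (int n)))\<^sup>2) \<longlonglongrightarrow> 0" by (rule summable_LIMSEQ_zero)
      then have "(\<lambda>n. sqrt ((cmod (p (int n)))\<^sup>2)) \<longlonglongrightarrow> sqrt 0" by (rule tendsto_real_sqrt)
      then have lim: "(\<lambda>n. cmod (p (int n))) \<longlonglongrightarrow> 0" by simp
      then have lim': "(\<lambda>n. cmod (p (int (Suc n)))) \<longlonglongrightarrow> 0" by (rule LIMSEQ_Suc)
      have "(\<lambda>n. cmod (p (int n)) * K + cmod (p (int (Suc n))) * K) \<longlonglongrightarrow> 0 * K + 0 * K"
        by (intro tendsto_intros lim lim')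
      moreover have "cmod \<kappa> \<le> cmod (p (int n)) * K + cmod (p (int (Suc n))) * K" for n
      proof -
        have "cmod \<kappa> \<le> cmod (p (int n)) * cmod (q (int n + 1)) + cmod (p (int n + 1)) * cmod (q (int n))"
          using \<kappa>(1)[rule_format, of "int n"] norm_triangle_ineq4[of "p (int n) * q (int n + 1)" "p (int n + 1) * q (int n)"]
          by (simp add: norm_mult)
        also have "\<dots> \<le> cmod (p (int n)) * K + cmod (p (int n + 1)) * K"
          using qK by (intro add_mono mult_left_mono) auto
        finally show ?thesis by (simp add: add.commute)
      qed
      ultimately have "cmod \<kappa> \<le> 0 * K + 0 * K"
        by (intro LIMSEQ_le_const) auto
      with \<kappa>(2) show False by simp
    qed
  qed (use C in auto)
qed

section \<open>Arithmetic of the frequency and the energies\<close>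

text \<open>Up to \<open>pi / 3\<close>, \<open>sin u \<ge> u * cos u \<ge> u / 2\<close>, as
  \<open>sin u - u * cos u\<close> has derivative \<open>u * sin u\<close>. Beyond,
  \<open>sin u\<close> is at least 0.85 while \<open>u / 2\<close> is at most 0.8.\<close>

lemma abs_sin_ge_half:
  fixes u :: real
  assumes "\<bar>u\<bar> \<le> pi / 2"
  shows "\<bar>u\<bar> / 2 \<le> \<bar>sin u\<bar>"
proof -
  have pos: "u / 2 \<le> sin u" if u: "0 \<le> u" "u \<le> pi / 2" for u :: real
  proof (cases "u \<le> pi / 3")
    case True
    have "(\<lambda>x. sin x - x * cos x) 0 \<le> (\<lambda>x. sin x - x * cos x) u"
    proof (rule DERIV_nonneg_imp_nondecreasing[OF u(1)])
      fix x assume x: "0 \<le> x" "x \<le> u"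
      have "((\<lambda>x. sin x - x * cos x) has_real_derivative (x * sin x)) (at x)"
        by (auto intro!: derivative_eq_intros)
      moreover have "x * sin x \<ge> 0" using x u by (intro mult_nonneg_nonneg sin_ge_zero) auto
      ultimately show "\<exists>y. ((\<lambda>x. sin x - x * cos x) has_real_derivative y) (at x) \<and> 0 \<le> y" by blast
    qed
    then have "u * cos u \<le> sin u" by simp
    moreover have "cos (pi / 3) \<le> cos u" using True u by (intro cos_monotone_0_pi_le) auto
    then have "u * (1 / 2) \<le> u * cos u" using u by (intro mult_left_mono) (auto simp: cos_60)
    ultimately show ?thesis by simp
  next
    case False
    have "sin (pi / 3) \<le> sin u" using False u by (intro sin_monotone_2pi_le) auto
    moreover have "(1.7::real) \<le> sqrt 3" by (rule real_le_rsqrt) (simp add: power2_eq_square)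
    moreover have "u \<le> 1.6" using u pi_approx by simp
    ultimately show ?thesis by (simp add: sin_60)
  qed
  show ?thesis using pos[of u] pos[of "- u"] assms by (cases "u \<ge> 0") auto
qed

text \<open>With \<open>n\<close> the integer nearest to \<open>t / (2 * pi)\<close>, the chord has
  length \<open>2 * \<bar>sin (s / 2)\<bar>\<close> for the reduced angle \<open>s\<close>, and
  \<open>abs_sin_ge_half\<close> applies to \<open>s / 2\<close>.\<close>

lemma norm_one_minus_exp_ge_dist:
  fixes t :: real
  obtains n :: int where "\<bar>t - 2 * pi * of_int n\<bar> / 2 \<le> cmod (1 - exp (\<i> * of_real t))"
proof
  define n where "n = round (t / (2 * pi))"
  define s where "s = t - 2 * pi * of_int n"
  have "\<bar>of_int n - t / (2 * pi)\<bar> \<le> 1 / 2" unfolding n_def by (rule of_int_round_abs_le)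
  then have "2 * pi * \<bar>of_int n - t / (2 * pi)\<bar> \<le> 2 * pi * (1 / 2)" by (intro mult_left_mono) auto
  moreover have "2 * pi * \<bar>of_int n - t / (2 * pi)\<bar> = \<bar>2 * pi * (of_int n - t / (2 * pi))\<bar>"
    by (simp add: abs_mult)
  moreover have "2 * pi * (of_int n - t / (2 * pi)) = - s" by (simp add: s_def field_simps)
  ultimately have s: "\<bar>s / 2\<bar> \<le> pi / 2" by simp
  have "exp (\<i> * of_real t) = exp (\<i> * of_real s)"
    unfolding exp_eq by (intro exI[of _ n]) (simp add: s_def algebra_simps)
  then have "cmod (1 - exp (\<i> * of_real t)) = 2 * \<bar>sin (s / 2)\<bar>"
    using dist_exp_i_1[of s] by (simp add: norm_minus_commute)
  with abs_sin_ge_half[OF s] show "\<bar>t - 2 * pi * of_int n\<bar> / 2 \<le> cmod (1 - exp (\<i> * of_real t))"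
    by (simp add: s_def)
qed

lemma DC1_small_divisors:
  assumes "\<alpha> \<in> DC1 \<tau>"
  shows "\<exists>c>0. \<exists>T. \<forall>n::nat. n \<ge> 1 \<longrightarrow> c / real n ^ T \<le> cmod (1 - exp (\<i> * of_real \<alpha>) ^ n)"
proof -
  obtain \<gamma> where \<gamma>: "0 < \<gamma>" "\<gamma> < 1"
    and dc: "\<And>k::int. k \<noteq> 0 \<Longrightarrow> \<gamma> / (1 + \<bar>real_of_int k\<bar> powr \<tau>) \<le> (INF n::int. \<bar>real_of_int k * \<alpha> - 2 * pi * real_of_int n\<bar>)"
    using assms unfolding DC1_def DC1_const_def by auto
  define T where "T = nat \<lceil>\<tau>\<rceil>"
  show ?thesis
  proof (intro exI conjI allI impI)
    \<comment> \<open>One factor 2 comes from \<open>1 + n powr \<tau> \<le> 2 * n ^ T\<close>, the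
      other from comparing chord and angle.\<close>
    show "0 < \<gamma> / 4" using \<gamma> by simp
    fix n :: nat assume n: "n \<ge> 1"
    obtain m :: int where m: "\<bar>real n * \<alpha> - 2 * pi * of_int m\<bar> / 2 \<le> cmod (1 - exp (\<i> * of_real (real n * \<alpha>)))"
      by (rule norm_one_minus_exp_ge_dist)
    have "(INF l::int. \<bar>real_of_int (int n) * \<alpha> - 2 * pi * real_of_int l\<bar>) \<le> \<bar>real_of_int (int n) * \<alpha> - 2 * pi * real_of_int m\<bar>"
      by (rule cINF_lower) (auto intro!: bdd_belowI[of _ 0])
    with dc[of "int n"] n have 1: "\<gamma> / (1 + real n powr \<tau>) \<le> \<bar>real n * \<alpha> - 2 * pi * of_int m\<bar>" by simp
    have "real n powr \<tau> \<le> real n powr real T"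
      using n unfolding T_def by (intro powr_mono) linarith+
    also have "\<dots> = real n ^ T" using n by (simp add: powr_realpow)
    finally have "real n powr \<tau> \<le> real n ^ T" .
    moreover have "1 \<le> real n ^ T" using n by (intro one_le_power) simp
    ultimately have "1 + real n powr \<tau> \<le> 2 * real n ^ T" by linarith
    then have "\<gamma> / (2 * real n ^ T) \<le> \<gamma> / (1 + real n powr \<tau>)"
      using \<gamma> n by (intro divide_left_mono mult_pos_pos) (auto intro: add_pos_nonneg)
    from divide_right_mono[OF order_trans[OF this 1], of 2]
    have "\<gamma> / (2 * real n ^ T) / 2 \<le> \<bar>real n * \<alpha> - 2 * pi * of_int m\<bar> / 2" by (simp only: zero_le_numeral)
    also note m
    finally have "\<gamma> / (2 * real n ^ T) / 2 \<le> cmod (1 - exp (\<i> * of_real (real n * \<alpha>)))" .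
    then show "\<gamma> / 4 / real n ^ T \<le> cmod (1 - exp (\<i> * of_real \<alpha>) ^ n)"
      by (simp add: exp_of_nat_mult[symmetric] mult.left_commute mult.commute)
  qed
qed

text \<open>The roots of \<open>y\<^sup>2 - E * y + 1\<close> are inverse to each other, so one of
  them lies in the closed unit disc.\<close>

lemma joukowski_preimage:
  fixes E :: complex
  obtains z where "z \<noteq> 0" "cmod z \<le> 1" "E = z + inverse z"
proof -
  define y where "y = (E + csqrt (E\<^sup>2 - 4)) / 2"
  have "2 * y - E = csqrt (E\<^sup>2 - 4)" by (simp add: y_def field_simps)
  then have "(2 * y - E)\<^sup>2 = E\<^sup>2 - 4" by simp
  then have "4 * (y * (E - y)) = 4 * 1" by (simp add: power2_eq_square algebra_simps)
  then have y: "y * (E - y) = 1" by (subst (asm) mult_left_cancel) auto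
  then have y0: "y \<noteq> 0" by auto
  then have Ey: "E = y + inverse y" using y by (simp add: field_simps)
  show thesis
  proof (cases "cmod y \<le> 1")
    case True
    then show ?thesis using that y0 Ey by blast
  next
    case False
    then have "cmod (inverse y) \<le> 1" by (simp add: norm_inverse inverse_le_1_iff)
    then show ?thesis using that[of "inverse y"] y0 Ey by (simp add: add.commute)
  qed
qed

lemma joukowski_unit_circle:
  assumes "cmod z = 1"
  shows "z + inverse z \<in> complex_of_real ` {-2..2}"
proof -
  have "inverse z = cnj z" using assms by (simp add: inverse_complex_def complex_cnj complex_eq_iff cmod_def)
  then have "z + inverse z = complex_of_real (2 * Re z)" by (simp add: complex_add_cnj)
  moreover have "\<bar>Re z\<bar> \<le> 1" using abs_Re_le_cmod[of z] assms by simp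
  ultimately show ?thesis by (intro image_eqI[of _ _ "2 * Re z"]) auto
qed

text \<open>The phases are \<open>\<alpha> / 4\<close> plus the multiples of
  \<open>\<alpha> / 2\<close>. Modulo \<open>2 * pi\<close> they are dense by Kronecker's theorem,
  since a rational \<open>\<alpha> / (4 * pi)\<close> would make
  \<open>exp (\<i> * \<alpha>)\<close> a root of unity.\<close>

lemma quarter_phases_dense:
  fixes \<alpha> E \<delta> :: real
  assumes nz: "\<And>n::nat. n \<ge> 1 \<Longrightarrow> exp (\<i> * of_real \<alpha>) ^ n \<noteq> 1"
    and E: "E \<in> {-2..2}" and \<delta>: "\<delta> > 0"
  shows "\<exists>m::nat. \<bar>2 * cos ((2 * real m + 1) * \<alpha> / 4) - E\<bar> < \<delta>"
proof -
  define \<theta> where "\<theta> = \<alpha> / (4 * pi)"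
  have irr: "\<theta> \<notin> \<rat>"
  proof
    assume "\<theta> \<in> \<rat>"
    then obtain p q :: int where q: "q > 0" "\<theta> = of_int p / of_int q"
      by (rule Rats_cases') 
    then have "real_of_int q * \<alpha> = 4 * pi * of_int p" by (simp add: \<theta>_def field_simps)
    then have "real (nat q) * \<alpha> = 2 * pi * of_int (2 * p)" using q by simp
    moreover have "exp (\<i> * of_real \<alpha>) ^ nat q = exp (\<i> * of_real (real (nat q) * \<alpha>))"
      by (simp add: exp_of_nat_mult[symmetric] mult_ac)
    ultimately have "exp (\<i> * of_real \<alpha>) ^ nat q = exp (\<i> * of_real (2 * pi * of_int (2 * p)))" by simp
    also have "\<dots> = 1" unfolding exp_eq_1 by (auto intro!: exI[of _ "2 * p"])
    finally show False using nz[of "nat q"] q by simp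
  qed
  define \<phi> where "\<phi> = arccos (E / 2)"
  have \<phi>: "cos \<phi> = E / 2" using E by (simp add: \<phi>_def)
  define t where "t = frac ((\<phi> - \<alpha> / 4) / (2 * pi))"
  have "t \<in> closure (range (\<lambda>n. frac (real n * \<theta>)))"
    unfolding Kronecker_approx_1[OF irr] by (simp add: t_def less_imp_le[OF frac_lt_1])
  moreover have "\<delta> / (4 * pi) > 0" using \<delta> by simp
  ultimately obtain m :: nat where m: "\<bar>frac (real m * \<theta>) - t\<bar> < \<delta> / (4 * pi)"
    unfolding closure_approachable by (auto simp: dist_real_def)
  define A where "A = \<alpha> / 4 + 2 * pi * frac (real m * \<theta>)"
  define B where "B = \<alpha> / 4 + 2 * pi * t"
  have cos_shift: "cos (x + 2 * pi * of_int k) = cos x" for x :: real and k :: int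
    using cos.plus_of_int[of x k] by (simp add: mult_ac)
  have "(2 * real m + 1) * \<alpha> / 4 = A + 2 * pi * of_int \<lfloor>real m * \<theta>\<rfloor>"
    by (simp add: A_def frac_def \<theta>_def field_simps)
  then have cA: "cos ((2 * real m + 1) * \<alpha> / 4) = cos A" by (simp only: cos_shift)
  have "\<phi> = B + 2 * pi * of_int \<lfloor>(\<phi> - \<alpha> / 4) / (2 * pi)\<rfloor>"
    by (simp add: B_def t_def frac_def field_simps)
  then have cB: "cos B = E / 2" using \<phi> cos_shift[of B] by metis
  have "\<bar>cos A - cos B\<bar> = 2 * \<bar>sin ((A + B) / 2)\<bar> * \<bar>sin ((B - A) / 2)\<bar>"
    by (simp add: cos_diff_cos abs_mult)
  also have "\<dots> \<le> 2 * 1 * \<bar>(B - A) / 2\<bar>"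
    using abs_sin_x_le_abs_x[of "(B - A) / 2"] by (intro mult_mono) auto
  also have "\<dots> = \<bar>A - B\<bar>" by simp
  also have "A - B = 2 * pi * (frac (real m * \<theta>) - t)" by (simp add: A_def B_def algebra_simps)
  also have "\<bar>2 * pi * (frac (real m * \<theta>) - t)\<bar> = 2 * pi * \<bar>frac (real m * \<theta>) - t\<bar>" by (simp add: abs_mult)
  also have "\<dots> < 2 * pi * (\<delta> / (4 * pi))" using m by (intro mult_strict_left_mono) auto
  finally have "\<bar>cos A - cos B\<bar> < \<delta> / 2" by simp
  then have "\<bar>2 * cos ((2 * real m + 1) * \<alpha> / 4) - E\<bar> < \<delta>" unfolding cA cB by (simp add: abs_if split: if_splits)
  then show ?thesis ..
qed

text \<open>For \<open>z = exp (\<i> (2m + 1) \<alpha> / 4)\<close> the square of \<open>z\<^sup>2 b\<^sup>n\<close>, \<open>b = a\<close> or \<open>b = 1 / a\<close>, is an odd power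
  of \<open>a\<close>: no resonance occurs.\<close>

lemma odd_quarter_phase_divisors:
  fixes a z b :: complex and c :: real
  assumes a: "cmod a = 1" and c: "c > 0" and z: "cmod z = 1" "z ^ 4 = a ^ (2 * m + 1)"
    and b: "b = a \<or> b = inverse a"
    and dc: "\<And>n::nat. n \<ge> 1 \<Longrightarrow> c / real n ^ T \<le> cmod (1 - a ^ n)"
  shows "\<exists>d>0. \<forall>n::nat. n \<ge> 1 \<longrightarrow> d / real n ^ T \<le> cmod (1 - z\<^sup>2 * b ^ n)"
proof (intro exI conjI allI impI)
  \<comment> \<open>The power comes from \<open>j \<le> (2 * m + 3) * n\<close> for the exponent
    \<open>j\<close> obtained below, the 2 from \<open>cmod (1 + y) \<le> 2\<close> in
    \<open>1 - y\<^sup>2 = (1 - y) * (1 + y)\<close>.\<close>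
  show "0 < c / real (2 * m + 3) ^ T / 2" using c by simp
  fix n :: nat assume n: "n \<ge> 1"
  have a0: "a \<noteq> 0" using a by auto
  have b1: "cmod b = 1" using a b by (auto simp: norm_inverse)
  define y where "y = z\<^sup>2 * b ^ n"
  have y: "cmod y = 1" using z b1 by (simp add: y_def norm_mult norm_power)
  have y2: "y\<^sup>2 = a ^ (2 * m + 1) * b ^ (2 * n)"
    using z(2) by (simp add: y_def power_mult_distrib flip: power_mult) (simp add: mult.commute)
  have inv: "cmod (1 - inverse a ^ j) = cmod (1 - a ^ j)" for j
  proof -
    have "1 - a ^ j = - (a ^ j * (1 - inverse a ^ j))" using a0 by (simp add: algebra_simps power_inverse)
    then show ?thesis by (simp add: norm_mult norm_power a)
  qed
  obtain j where j: "j \<ge> 1" "j \<le> 2 * m + 1 + 2 * n" "cmod (1 - y\<^sup>2) = cmod (1 - a ^ j)"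
  proof (cases "b = a")
    case True
    have "y\<^sup>2 = a ^ (2 * m + 1 + 2 * n)" unfolding y2 True by (simp add: power_add)
    then show thesis by (intro that[of "2 * m + 1 + 2 * n"]) auto
  next
    case False
    with b have b': "b = inverse a" by simp
    show thesis
    proof (cases "2 * n \<le> 2 * m + 1")
      case True
      then have "2 * m + 1 = (2 * m + 1 - 2 * n) + 2 * n" by simp
      then have "a ^ (2 * m + 1) = a ^ (2 * m + 1 - 2 * n) * a ^ (2 * n)" by (metis power_add)
      then have "y\<^sup>2 = a ^ (2 * m + 1 - 2 * n)" unfolding y2 b' using a0 by (simp add: power_inverse)
      moreover have "2 * m + 1 - 2 * n \<ge> 1" using True by presburger
      ultimately show thesis by (intro that[of "2 * m + 1 - 2 * n"]) auto
    next
      case False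
      then have "2 * n = (2 * n - (2 * m + 1)) + (2 * m + 1)" by simp
      then have "b ^ (2 * n) = b ^ (2 * n - (2 * m + 1)) * b ^ (2 * m + 1)" by (metis power_add)
      moreover have "a ^ (2 * m + 1) * b ^ (2 * m + 1) = 1"
        unfolding b' power_mult_distrib[symmetric] using a0 by simp
      ultimately have "y\<^sup>2 = b ^ (2 * n - (2 * m + 1))"
        unfolding y2 by (simp only: mult.left_commute[of "a ^ (2 * m + 1)"] mult_1_right)
      then have "y\<^sup>2 = inverse a ^ (2 * n - (2 * m + 1))" by (simp only: b')
      with inv have "cmod (1 - y\<^sup>2) = cmod (1 - a ^ (2 * n - (2 * m + 1)))" by simp
      moreover have "2 * n - (2 * m + 1) \<ge> 1" using False by presburger
      ultimately show thesis by (intro that[of "2 * n - (2 * m + 1)"]) auto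
    qed
  qed
  have "j \<le> (2 * m + 3) * n" using j(2) n mult_le_mono2[OF n, of "2 * m + 1"] by (simp add: algebra_simps)
  then have "real j \<le> real (2 * m + 3) * real n" by (metis of_nat_mono of_nat_mult)
  then have "real j ^ T \<le> (real (2 * m + 3) * real n) ^ T" by (rule power_mono) simp
  then have "c / (real (2 * m + 3) * real n) ^ T \<le> c / real j ^ T"
    using c j n by (intro divide_left_mono mult_pos_pos zero_less_power) auto
  also have "\<dots> \<le> cmod (1 - y\<^sup>2)" using dc[OF j(1)] j(3) by simp
  also have "1 - y\<^sup>2 = (1 - y) * (1 + y)" by (simp add: power2_eq_square algebra_simps)
  also have "cmod ((1 - y) * (1 + y)) \<le> cmod (1 - y) * 2"
    unfolding norm_mult using norm_triangle_ineq[of 1 y] y by (intro mult_left_mono) auto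
  finally have le: "c / (real (2 * m + 3) * real n) ^ T / 2 \<le> cmod (1 - y)" by simp
  have "c / real (2 * m + 3) ^ T / 2 / real n ^ T = c / (real (2 * m + 3) * real n) ^ T / 2"
    by (simp add: power_mult_distrib)
  also note le
  finally show "c / real (2 * m + 3) ^ T / 2 / real n ^ T \<le> cmod (1 - z\<^sup>2 * b ^ n)"
    by (simp add: y_def)
qed

section \<open>The spectrum\<close>

text \<open>The second solution carries \<open>z powi (- n)\<close>; exchanging the roles of
  \<open>z\<close> and its inverse amounts to replacing \<open>a\<close> by its inverse in the
  coefficient equation, at the same energy.\<close>

lemma bloch_solutions:
  fixes w :: "int \<Rightarrow> complex"
  assumes P: "bloch_coeffs a z \<beta> P" and Q: "bloch_coeffs (inverse a) z \<beta> Q"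
    and \<beta>: "summable (\<lambda>k. cmod (\<beta> $ k))" and a: "cmod a = 1" and z: "z \<noteq> 0"
    and nz: "\<And>n. n \<ge> 1 \<Longrightarrow> a ^ n \<noteq> 1"
    and w: "\<And>n. cmod (w n) = 1" "\<And>n. w (n + 1) = a * w n"
  shows "\<exists>p q K. (\<forall>n. p (n + 1) + p (n - 1) + eval_fps \<beta> (w n) * p n = (z + inverse z) * p n) \<and>
     (\<forall>n. q (n + 1) + q (n - 1) + eval_fps \<beta> (w n) * q n = (z + inverse z) * q n) \<and>
     (\<forall>n. p n * q (n + 1) - p (n + 1) * q n = inverse z - z) \<and>
     (\<forall>n. cmod (p n) \<le> K * cmod z powi n) \<and> (\<forall>n. cmod (q n) \<le> K * cmod z powi (- n))"
proof -
  define p where "p n = z powi n * eval_fps P (w n)" for n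
  define q where "q n = z powi (- n) * eval_fps Q (w n)" for n
  have a0: "a \<noteq> 0" using a by auto
  have w': "w (n - 1) = inverse a * w n" for n using w(2)[of "n - 1"] a0 by simp
  have zp: "z powi (n + 1) = z powi n * z" "z powi (n - 1) = z powi n * inverse z"
    "z powi (- (n + 1)) = z powi (- n) * inverse z" "z powi (- (n - 1)) = z powi (- n) * z" for n
    using z by (auto simp: power_int_add power_int_diff power_int_minus field_simps)
  have ia: "cmod (inverse a) = 1" using a by (simp add: norm_inverse)
  define K where "K = max (\<Sum>k. cmod (P $ k)) (\<Sum>k. cmod (Q $ k))"
  have bd: "cmod (eval_fps F (w n)) \<le> (\<Sum>k. cmod (F $ k))" if "summable (\<lambda>k. cmod (F $ k))" for F n
  proof -
    have "cmod (eval_fps F (w n)) \<le> (\<Sum>k. cmod (F $ k * w n ^ k))"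
      unfolding eval_fps_def by (intro summable_norm summable_norm_powser_unit_disc that) (simp add: w)
    then show ?thesis by (simp add: norm_mult norm_power w)
  qed
  have sP: "summable (\<lambda>k. cmod (P $ k))" "summable (\<lambda>k. cmod (Q $ k))"
    using P Q by (auto simp: bloch_coeffs_def)
  have "p (n + 1) + p (n - 1) + eval_fps \<beta> (w n) * p n = (z + inverse z) * p n" for n
  proof -
    have "p (n + 1) + p (n - 1) + eval_fps \<beta> (w n) * p n
        = z powi n * (z * eval_fps P (a * w n) + inverse z * eval_fps P (inverse a * w n) + eval_fps \<beta> (w n) * eval_fps P (w n))"
      unfolding p_def w w' zp by (simp add: algebra_simps)
    also have "\<dots> = z powi n * ((z + inverse z) * eval_fps P (w n))"
      by (subst bloch_coeffs_equation[OF P \<beta> a]) (simp_all add: w)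
    finally show ?thesis by (simp add: p_def)
  qed
  moreover have "q (n + 1) + q (n - 1) + eval_fps \<beta> (w n) * q n = (z + inverse z) * q n" for n
  proof -
    have "q (n + 1) + q (n - 1) + eval_fps \<beta> (w n) * q n
        = z powi (- n) * (z * eval_fps Q (inverse a * w n) + inverse z * eval_fps Q (inverse (inverse a) * w n) + eval_fps \<beta> (w n) * eval_fps Q (w n))"
      unfolding q_def w w' zp by (simp add: algebra_simps)
    also have "\<dots> = z powi (- n) * ((z + inverse z) * eval_fps Q (w n))"
      by (subst bloch_coeffs_equation[OF Q \<beta> ia]) (simp_all add: w)
    finally show ?thesis by (simp add: q_def)
  qed
  moreover have "p n * q (n + 1) - p (n + 1) * q n = inverse z - z" for n
  proof -
    have zz: "z powi n * z powi (- n) = 1" using z by (simp add: power_int_minus)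
    have "p n * q (n + 1) - p (n + 1) * q n = (z powi n * z powi (- n)) *
        (inverse z * eval_fps P (w n) * eval_fps Q (a * w n) - z * eval_fps P (a * w n) * eval_fps Q (w n))"
      unfolding p_def q_def w zp by (simp add: algebra_simps)
    then show ?thesis unfolding zz using bloch_coeffs_wronskian[OF P Q a nz, of "w n"] by (simp add: w)
  qed
  moreover have "cmod (p n) \<le> K * cmod z powi n" for n
    using bd[OF sP(1), of n] by (simp add: p_def K_def norm_mult norm_power_int mult.commute[of "_ powi _"] mult_right_mono max.coboundedI1)
  moreover have "cmod (q n) \<le> K * cmod z powi (- n)" for n
    using bd[OF sP(2), of n] by (simp add: q_def K_def norm_mult norm_power_int mult.commute[of "_ powi _"] mult_right_mono max.coboundedI2)
  ultimately show ?thesis by blast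
qed

text \<open>The constant term is set to 0 by hand. Thus the one-sided expansion of \<open>v\<close>
  can be used directly, without first showing that \<open>fourier_coeff v 0\<close>
  vanishes.\<close>

definition coupling_fps :: "real \<Rightarrow> (complex \<Rightarrow> complex) \<Rightarrow> complex fps" where
  "coupling_fps lam v = Abs_fps (\<lambda>k. if k = 0 then 0 else of_real lam * fourier_coeff v (int k))"

lemma coupling_fps_strip_norm:
  assumes "v \<in> C_omega h"
  shows "summable (\<lambda>k. cmod (coupling_fps lam v $ k) * exp (h * real k))"
    and "(\<Sum>k. cmod (coupling_fps lam v $ k) * exp (h * real k)) \<le> \<bar>lam\<bar> * strip_norm h v"
proof -
  define f where "f k = cmod (fourier_coeff v k) * exp (h * \<bar>real_of_int k\<bar>)" for k
  have f: "f summable_on UNIV" using assms by (simp add: C_omega_def f_def[abs_def])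
  then have fr: "f summable_on range int" by (rule summable_on_subset) simp
  have "(f has_sum infsum f (range int)) (range int)" using fr by simp
  then have "((\<lambda>k. f (int k)) has_sum infsum f (range int)) UNIV"
    by (subst (asm) has_sum_reindex) (auto simp: o_def)
  then have "(\<lambda>k. f (int k)) sums infsum f (range int)" by (rule has_sum_imp_sums)
  then have g: "(\<lambda>k. \<bar>lam\<bar> * f (int k)) sums (\<bar>lam\<bar> * infsum f (range int))" by (rule sums_mult)
  have le: "cmod (coupling_fps lam v $ k) * exp (h * real k) \<le> \<bar>lam\<bar> * f (int k)" for k
    by (simp add: coupling_fps_def f_def norm_mult)
  show s: "summable (\<lambda>k. cmod (coupling_fps lam v $ k) * exp (h * real k))"
    by (rule summable_comparison_test'[OF sums_summable[OF g]]) (use le in auto)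
  have "(\<Sum>k. cmod (coupling_fps lam v $ k) * exp (h * real k)) \<le> \<bar>lam\<bar> * infsum f (range int)"
    using suminf_le[OF le s sums_summable[OF g]] sums_unique[OF g] by simp
  also have "\<dots> \<le> \<bar>lam\<bar> * strip_norm h v"
  proof (rule mult_left_mono)
    have "infsum f (range int) \<le> infsum f UNIV"
      by (rule infsum_mono2[OF fr f]) (auto simp: f_def)
    then show "infsum f (range int) \<le> strip_norm h v" by (simp add: strip_norm_def f_def[abs_def])
  qed simp
  finally show "(\<Sum>k. cmod (coupling_fps lam v $ k) * exp (h * real k)) \<le> \<bar>lam\<bar> * strip_norm h v" .
qed

lemma eval_coupling_fps:
  assumes "((\<lambda>k. fourier_coeff v k * exp (\<i> * of_int k * z)) has_sum v z) {k. k > 0}"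
  shows "eval_fps (coupling_fps lam v) (exp (\<i> * z)) = of_real lam * v z"
proof -
  have "bij_betw int {k. k > 0} {k. k > 0}"
    by (rule bij_betwI[of _ _ _ nat]) auto
  then have "((\<lambda>k. fourier_coeff v (int k) * exp (\<i> * of_int (int k) * z)) has_sum v z) {k. k > 0}"
    using has_sum_reindex_bij_betw[where f = "\<lambda>k. fourier_coeff v k * exp (\<i> * of_int k * z)"] assms by blast
  then have "((\<lambda>k. of_real lam * (fourier_coeff v (int k) * exp (\<i> * of_int (int k) * z))) has_sum of_real lam * v z) {k. k > 0}"
    by (rule has_sum_cmult_right)
  also have "?this \<longleftrightarrow> ((\<lambda>k. coupling_fps lam v $ k * exp (\<i> * z) ^ k) has_sum of_real lam * v z) UNIV"
    by (rule has_sum_cong_neutral) (auto simp: coupling_fps_def exp_of_nat_mult[symmetric] mult_ac)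
  finally show ?thesis
    unfolding eval_fps_def by (metis has_sum_imp_sums sums_unique)
qed

theorem corollary1p1:
  fixes \<tau> h \<alpha> M :: real
  assumes "\<tau> > 1" and "h > 0" and "\<alpha> \<in> DC1 \<tau>"
  shows "\<exists>lam1>0. \<forall>v \<in> C_omega h.
    strip_norm h v = M \<longrightarrow>
    (\<forall>z. \<bar>Im z\<bar> < h \<longrightarrow>
       ((\<lambda>k. fourier_coeff v k * exp (\<i> * of_int k * z)) has_sum v z) {k. k > 0}) \<longrightarrow>
    (\<forall>lam::real. \<bar>lam\<bar> < lam1 \<longrightarrow>
       (\<forall>x::real. l2_spectrum (schroedinger (\<lambda>z. complex_of_real lam * v z) \<alpha> x)
                  = complex_of_real ` {-2..2}))"
proof -
  define a where "a = exp (\<i> * of_real \<alpha>)"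
  have a: "cmod a = 1" by (simp add: a_def)
  then have ia: "cmod (inverse a) = 1" and a0: "a \<noteq> 0" by (auto simp: norm_inverse)
  obtain c T where c: "c > 0" and dc: "\<And>n::nat. n \<ge> 1 \<Longrightarrow> c / real n ^ T \<le> cmod (1 - a ^ n)"
    using DC1_small_divisors[OF assms(3)] unfolding a_def by blast
  have dc': "c / real n ^ T \<le> cmod (1 - inverse a ^ n)" if "n \<ge> 1" for n
  proof -
    have "1 - a ^ n = - (a ^ n * (1 - inverse a ^ n))" using a0 by (simp add: algebra_simps power_inverse)
    then have "cmod (1 - a ^ n) = cmod (1 - inverse a ^ n)" by (simp add: norm_mult norm_power a)
    with dc[OF that] show ?thesis by simp
  qed
  have nz: "a ^ n \<noteq> 1" if "n \<ge> 1" for n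
    using less_le_trans[OF divide_pos_pos dc[OF that]] c that by auto
  obtain e1 where e1: "e1 > 0" and ex1: "\<forall>z d \<beta>. z \<noteq> 0 \<longrightarrow> cmod z \<le> 1 \<longrightarrow> d > 0 \<longrightarrow>
      (\<forall>n::nat. n \<ge> 1 \<longrightarrow> d / real n ^ T \<le> cmod (1 - z\<^sup>2 * a ^ n)) \<longrightarrow>
      \<beta> $ 0 = 0 \<longrightarrow> summable (\<lambda>k. cmod (\<beta> $ k) * exp (h * real k)) \<longrightarrow>
      (\<Sum>k. cmod (\<beta> $ k) * exp (h * real k)) \<le> e1 \<longrightarrow> (\<exists>P. bloch_coeffs a z \<beta> P)"
    using bloch_coeffs_exist[OF a c assms(2) dc] by blast
  obtain e2 where e2: "e2 > 0" and ex2: "\<forall>z d \<beta>. z \<noteq> 0 \<longrightarrow> cmod z \<le> 1 \<longrightarrow> d > 0 \<longrightarrow>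
      (\<forall>n::nat. n \<ge> 1 \<longrightarrow> d / real n ^ T \<le> cmod (1 - z\<^sup>2 * inverse a ^ n)) \<longrightarrow>
      \<beta> $ 0 = 0 \<longrightarrow> summable (\<lambda>k. cmod (\<beta> $ k) * exp (h * real k)) \<longrightarrow>
      (\<Sum>k. cmod (\<beta> $ k) * exp (h * real k)) \<le> e2 \<longrightarrow> (\<exists>P. bloch_coeffs (inverse a) z \<beta> P)"
    using bloch_coeffs_exist[OF ia c assms(2) dc'] by blast
  \<comment> \<open>Both thresholds \<open>e1\<close> and \<open>e2\<close> were fixed before the
    potential and the energy; adding 1 keeps the denominator positive for every
    \<open>M\<close>.\<close>
  show ?thesis
  proof (intro exI[of _ "min e1 e2 / (\<bar>M\<bar> + 1)"] conjI ballI impI allI)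
    show "0 < min e1 e2 / (\<bar>M\<bar> + 1)" using e1 e2 by simp
    fix v lam x
    assume v: "v \<in> C_omega h" "strip_norm h v = M"
      and pos: "\<forall>z. \<bar>Im z\<bar> < h \<longrightarrow>
         ((\<lambda>k. fourier_coeff v k * exp (\<i> * of_int k * z)) has_sum v z) {k. k > 0}"
      and lam: "\<bar>lam\<bar> < min e1 e2 / (\<bar>M\<bar> + 1)"
    define \<beta> where "\<beta> = coupling_fps lam v"
    have \<beta>0: "\<beta> $ 0 = 0" by (simp add: \<beta>_def coupling_fps_def)
    have \<beta>s: "summable (\<lambda>k. cmod (\<beta> $ k) * exp (h * real k))"
      unfolding \<beta>_def by (rule coupling_fps_strip_norm[OF v(1)])
    have "(\<Sum>k. cmod (\<beta> $ k) * exp (h * real k)) \<le> \<bar>lam\<bar> * M"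
      using coupling_fps_strip_norm(2)[OF v(1), of lam] v(2) by (simp add: \<beta>_def)
    also have "\<dots> \<le> \<bar>lam\<bar> * (\<bar>M\<bar> + 1)" by (intro mult_left_mono) auto
    also have "\<dots> \<le> min e1 e2" using lam by (simp add: pos_less_divide_eq less_imp_le)
    finally have \<beta>e: "(\<Sum>k. cmod (\<beta> $ k) * exp (h * real k)) \<le> e1" "(\<Sum>k. cmod (\<beta> $ k) * exp (h * real k)) \<le> e2"
      by auto
    have \<beta>1: "summable (\<lambda>k. cmod (\<beta> $ k))"
    proof (rule summable_comparison_test'[OF \<beta>s])
      show "norm (cmod (\<beta> $ k)) \<le> cmod (\<beta> $ k) * exp (h * real k)" for k
        using assms(2) mult_left_mono[of 1 "exp (h * real k)" "cmod (\<beta> $ k)"] by simp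
    qed
    define w where "w n = exp (\<i> * of_real (x + real_of_int n * \<alpha>))" for n
    have w: "cmod (w n) = 1" "w (n + 1) = a * w n" for n
      by (simp_all add: w_def a_def algebra_simps flip: exp_add)
    define V where "V n = eval_fps \<beta> (w n)" for n
    have V: "V n = of_real lam * v (of_real (x + real_of_int n * \<alpha>))" for n
      unfolding V_def \<beta>_def w_def by (rule eval_coupling_fps) (use pos assms(2) in auto)
    have H: "schroedinger (\<lambda>z. complex_of_real lam * v z) \<alpha> x = lattice_schroedinger V"
      by (intro ext) (simp add: schroedinger_def lattice_schroedinger_def V)
    have sol: "\<exists>p q K. (\<forall>n. p (n + 1) + p (n - 1) + V n * p n = (z + inverse z) * p n) \<and>
       (\<forall>n. q (n + 1) + q (n - 1) + V n * q n = (z + inverse z) * q n) \<and>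
       (\<forall>n. p n * q (n + 1) - p (n + 1) * q n = inverse z - z) \<and>
       (\<forall>n. cmod (p n) \<le> K * cmod z powi n) \<and> (\<forall>n. cmod (q n) \<le> K * cmod z powi (- n))"
      if z: "z \<noteq> 0" "cmod z \<le> 1" and d: "d > 0" "d' > 0"
        and n: "\<forall>n::nat. n \<ge> 1 \<longrightarrow> d / real n ^ T \<le> cmod (1 - z\<^sup>2 * a ^ n)"
        "\<forall>n::nat. n \<ge> 1 \<longrightarrow> d' / real n ^ T \<le> cmod (1 - z\<^sup>2 * inverse a ^ n)" for z d d'
    proof -
      have "\<exists>P. bloch_coeffs a z \<beta> P" using ex1 z d(1) n(1) \<beta>0 \<beta>s \<beta>e(1) by blast
      moreover have "\<exists>Q. bloch_coeffs (inverse a) z \<beta> Q" using ex2 z d(2) n(2) \<beta>0 \<beta>s \<beta>e(2) by blast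
      ultimately obtain P Q where PQ: "bloch_coeffs a z \<beta> P" "bloch_coeffs (inverse a) z \<beta> Q" by blast
      show ?thesis unfolding V_def by (rule bloch_solutions[OF PQ \<beta>1 a z(1)]) (erule nz | rule w)+
    qed
    have inside: "E \<in> l2_resolvent_set (lattice_schroedinger V)" if E: "E \<notin> complex_of_real ` {-2..2}" for E
    proof -
      obtain z where z: "z \<noteq> 0" "cmod z \<le> 1" "E = z + inverse z" by (rule joukowski_preimage)
      have z1: "cmod z < 1" using z E joukowski_unit_circle[of z] by fastforce
      \<comment> \<open>Strictly inside the disc the second divisor is bounded below by
        \<open>d\<close>, for \<open>a\<close> and for its inverse alike.\<close>
      define d where "d = 1 - (cmod z)\<^sup>2"
      have d: "d > 0" using z1 by (simp add: d_def power_less_one_iff)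
      have div: "\<forall>n::nat. n \<ge> 1 \<longrightarrow> d / real n ^ T \<le> cmod (1 - z\<^sup>2 * b ^ n)" if b: "cmod b = 1" for b
      proof (intro allI impI)
        fix n :: nat assume "n \<ge> 1"
        then have "d / real n ^ T \<le> d / 1" using d by (intro divide_left_mono) auto
        also have "\<dots> \<le> cmod (1 - z\<^sup>2 * b ^ n)"
          using norm_triangle_ineq2[of 1 "z\<^sup>2 * b ^ n"] by (simp add: d_def norm_mult norm_power b)
        finally show "d / real n ^ T \<le> cmod (1 - z\<^sup>2 * b ^ n)" .
      qed
      have \<kappa>: "inverse z - z \<noteq> 0"
      proof
        assume "inverse z - z = 0"
        then have "z\<^sup>2 = 1" using z(1) by (simp add: field_simps power2_eq_square)
        then have "(cmod z)\<^sup>2 = 1" by (metis norm_one norm_power)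
        then show False using d by (simp add: d_def)
      qed
      obtain p q K where "\<And>n. p (n + 1) + p (n - 1) + V n * p n = E * p n"
        "\<And>n. q (n + 1) + q (n - 1) + V n * q n = E * q n"
        "\<And>n. p n * q (n + 1) - p (n + 1) * q n = inverse z - z"
        "\<And>n. cmod (p n) \<le> K * cmod z powi n" "\<And>n. cmod (q n) \<le> K * cmod z powi (- n)"
        using sol[OF z(1,2) d d div[OF a] div[OF ia]] unfolding z(3) by blast
      with z1 z(1) \<kappa> show ?thesis by (intro decaying_solutions_resolvent[of "cmod z" p V E q "inverse z - z" K]) auto
    qed
    have spec: "complex_of_real E0 \<notin> l2_resolvent_set (lattice_schroedinger V)" if E0: "E0 \<in> {-2..2}" for E0
    proof
      assume "complex_of_real E0 \<in> l2_resolvent_set (lattice_schroedinger V)"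
      from bounded_solutions_away_from_resolvent[OF this]
      obtain \<delta> where \<delta>: "\<delta> > 0" and away: "\<And>E p q K \<kappa>. (\<forall>n. p (n + 1) + p (n - 1) + V n * p n = E * p n) \<Longrightarrow>
         (\<forall>n. p n * q (n + 1) - p (n + 1) * q n = \<kappa>) \<Longrightarrow> \<kappa> \<noteq> 0 \<Longrightarrow>
         (\<forall>n. cmod (p n) \<le> K) \<Longrightarrow> (\<forall>n. cmod (q n) \<le> K) \<Longrightarrow> \<delta> \<le> cmod (E - complex_of_real E0)"
        by meson
      obtain m :: nat where m: "\<bar>2 * cos ((2 * real m + 1) * \<alpha> / 4) - E0\<bar> < \<delta>"
        using quarter_phases_dense[OF nz[unfolded a_def] E0 \<delta>] by blast
      define t where "t = (2 * real m + 1) * \<alpha> / 4"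
      define z where "z = exp (\<i> * of_real t)"
      have z: "z \<noteq> 0" "cmod z = 1" by (auto simp: z_def)
      \<comment> \<open>The quarter phase makes \<open>z ^ 4\<close> an odd power of
        \<open>a\<close>. This excludes resonances, and also \<open>z\<^sup>2 = 1\<close>, the case
        of a vanishing Wronskian.\<close>
      have "z ^ 4 = exp (of_nat 4 * (\<i> * of_real t))" unfolding z_def by (rule exp_of_nat_mult[symmetric])
      also have "of_nat 4 * (\<i> * of_real t) = of_nat (2 * m + 1) * (\<i> * of_real \<alpha>)" by (simp add: t_def)
      also have "exp \<dots> = a ^ (2 * m + 1)" unfolding a_def by (rule exp_of_nat_mult)
      finally have z4: "z ^ 4 = a ^ (2 * m + 1)" .
      have \<kappa>: "inverse z - z \<noteq> 0"
      proof
        assume "inverse z - z = 0"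
        then have "z\<^sup>2 = 1" using z(1) by (simp add: field_simps power2_eq_square)
        then have "(z\<^sup>2)\<^sup>2 = 1" by simp
        then have "z ^ 4 = 1" by (simp flip: power_mult)
        then show False using nz[of "2 * m + 1"] z4 by simp
      qed
      have zz: "z + inverse z = complex_of_real (2 * cos t)"
        by (simp add: z_def cos_of_real[symmetric] cos_exp_eq exp_minus del: cos_of_real)
      obtain d d' where d: "d > 0" "d' > 0"
        "\<forall>n::nat. n \<ge> 1 \<longrightarrow> d / real n ^ T \<le> cmod (1 - z\<^sup>2 * a ^ n)"
        "\<forall>n::nat. n \<ge> 1 \<longrightarrow> d' / real n ^ T \<le> cmod (1 - z\<^sup>2 * inverse a ^ n)"
        using odd_quarter_phase_divisors[OF a c z(2) z4 _ dc, of a]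
          odd_quarter_phase_divisors[OF a c z(2) z4 _ dc, of "inverse a"] by blast
      have zle: "cmod z \<le> 1" using z by simp
      obtain p q K where pq: "\<forall>n. p (n + 1) + p (n - 1) + V n * p n = (z + inverse z) * p n"
        "\<forall>n. p n * q (n + 1) - p (n + 1) * q n = inverse z - z"
        "\<forall>n. cmod (p n) \<le> K * cmod z powi n" "\<forall>n. cmod (q n) \<le> K * cmod z powi (- n)"
        using sol[OF z(1) zle d] by blast
      \<comment> \<open>On the unit circle the growth bounds reduce to the constant
        \<open>K\<close>, so both solutions are bounded.\<close>
      have "\<delta> \<le> cmod (z + inverse z - complex_of_real E0)"
        using away[OF pq(1,2) \<kappa>, of K] pq(3,4) z by simp
      also have "\<dots> = \<bar>2 * cos t - E0\<bar>" unfolding zz by (simp only: of_real_diff[symmetric] norm_of_real)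
      finally show False using m by (simp add: t_def)
    qed
    show "l2_spectrum (schroedinger (\<lambda>z. complex_of_real lam * v z) \<alpha> x) = complex_of_real ` {-2..2}"
      unfolding H l2_spectrum_def using inside spec by auto
  qed
qed

end
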